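(* Let $K$ be an $\mathcal R$-dioid. For every $\phi\in K\otimes_{\mathcal R}C_2'$ there are $n\ge 1$, $S\in\{0,1\}^{1\times n}$, $F\in\{0,1\}^{n\times 1}$, $U\in\{0,p_0,p_1\}^{n\times n}$, $V\in\{0,q_0,q_1\}^{n\times n}$ and $N\in(Z_{C_2'}K)^{n\times n}$ such that \[ \phi=S(NV)^*N(UN)^*F. \] Moreover, $N$ is the least solution of $y\ge (UyV+N)^*$ in $\mathrm{Mat}_{n\times n}(Z_{C_2'}K)$.
   Context: An $\mathcal R$-dioid is a dioid in which every regular subset $A$ of its multiplicative monoid has a least upper bound $\sum A$ with $\sum(AB)=(\sum A)(\sum B)$; equivalently, a $*$-continuous Kleene algebra. An $\mathcal R$-morphism is a dioid morphism preserving suprema of regular sets; an $\mathcal R$-congruence is a semiring congruence $\rho$ such that regular sets with equal downward closures modulo $\rho$ have congruent suprema. $C_2'=\mathcal R\Delta_2^*/\rho$ with $\Delta_2=\{p_0,p_1,q_0,q_1\}$, $\mathcal R\Delta_2^*$ the algebra of regular languages over $\Delta_2$, and $\rho$ the least $\mathcal R$-congruence containing $p_iq_j=\delta_{i,j}$ ($i,j<2$). $K\otimes_{\mathcal R}C_2'$ is the tensor product of $\mathcal R$-dioids (universal $\mathcal R$-dioid receiving $\mathcal R$-morphisms from $K$ and $C_2'$ with elementwise commuting images); elements of $K,C_2'$ are identified with their images. $Z_{C_2'}K$ is the set of elements of $K\otimes_{\mathcal R}C_2'$ commuting with all elements of $C_2'$; it is closed under the Kleene algebra operations. Matrices carry the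 standard matrix Kleene algebra structure; scalars multiplied with matrices are identified with diagonal matrices. *)

theory Defs
  imports Main
begin

record 'a dioid =
  dcar :: "'a set"
  dplus :: "'a \<Rightarrow> 'a \<Rightarrow> 'a"
  dtimes :: "'a \<Rightarrow> 'a \<Rightarrow> 'a"
  dzero :: 'a
  dunit :: 'a

definition dioid :: "'a dioid \<Rightarrow> bool" where
  "dioid D \<longleftrightarrow>
     dzero D \<in> dcar D \<and> dunit D \<in> dcar D \<and>
     (\<forall>a\<in>dcar D. \<forall>b\<in>dcar D. dplus D a b \<in> dcar D \<and> dtimes D a b \<in> dcar D) \<and>
     (\<forall>a\<in>dcar D. \<forall>b\<in>dcar D. \<forall>c\<in>dcar D.
        dplus D (dplus D a b) c = dplus D a (dplus D b c) \<and>
        dtimes D (dtimes D a b) c = dtimes D a (dtimes D b c) \<and>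
        dtimes D a (dplus D b c) = dplus D (dtimes D a b) (dtimes D a c) \<and>
        dtimes D (dplus D a b) c = dplus D (dtimes D a c) (dtimes D b c)) \<and>
     (\<forall>a\<in>dcar D. \<forall>b\<in>dcar D. dplus D a b = dplus D b a) \<and>
     (\<forall>a\<in>dcar D. dplus D a a = a \<and> dplus D a (dzero D) = a \<and>
        dtimes D a (dunit D) = a \<and> dtimes D (dunit D) a = a \<and>
        dtimes D a (dzero D) = dzero D \<and> dtimes D (dzero D) a = dzero D)"

definition dleq :: "'a dioid \<Rightarrow> 'a \<Rightarrow> 'a \<Rightarrow> bool" where
  "dleq D a b \<longleftrightarrow> dplus D a b = b"

definition setmul :: "'a dioid \<Rightarrow> 'a set \<Rightarrow> 'a set \<Rightarrow> 'a set" where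
  "setmul D A B = {dtimes D a b | a b. a \<in> A \<and> b \<in> B}"

inductive_set mstar :: "'a dioid \<Rightarrow> 'a set \<Rightarrow> 'a set" for D A where
  mstar_unit: "dunit D \<in> mstar D A"
| mstar_step: "a \<in> A \<Longrightarrow> x \<in> mstar D A \<Longrightarrow> dtimes D a x \<in> mstar D A"

inductive_set rat :: "'a dioid \<Rightarrow> 'a set set" for D where
  rat_fin: "finite A \<Longrightarrow> A \<subseteq> dcar D \<Longrightarrow> A \<in> rat D"
| rat_un: "A \<in> rat D \<Longrightarrow> B \<in> rat D \<Longrightarrow> A \<union> B \<in> rat D"
| rat_mul: "A \<in> rat D \<Longrightarrow> B \<in> rat D \<Longrightarrow> setmul D A B \<in> rat D"
| rat_star: "A \<in> rat D \<Longrightarrow> mstar D A \<in> rat D"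

definition is_lub :: "'a dioid \<Rightarrow> 'a set \<Rightarrow> 'a \<Rightarrow> bool" where
  "is_lub D A s \<longleftrightarrow> s \<in> dcar D \<and> (\<forall>a\<in>A. dleq D a s) \<and>
     (\<forall>u\<in>dcar D. (\<forall>a\<in>A. dleq D a u) \<longrightarrow> dleq D s u)"

definition dSup :: "'a dioid \<Rightarrow> 'a set \<Rightarrow> 'a" where
  "dSup D A = (THE s. is_lub D A s)"

definition R_dioid :: "'a dioid \<Rightarrow> bool" where
  "R_dioid D \<longleftrightarrow> dioid D \<and> (\<forall>A\<in>rat D. \<exists>s. is_lub D A s) \<and>
     (\<forall>A\<in>rat D. \<forall>B\<in>rat D. dSup D (setmul D A B) = dtimes D (dSup D A) (dSup D B))"

definition dstar :: "'a dioid \<Rightarrow> 'a \<Rightarrow> 'a" where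
  "dstar D a = dSup D (mstar D {a})"

definition semiring_cong :: "'a dioid \<Rightarrow> 'a rel \<Rightarrow> bool" where
  "semiring_cong D \<rho> \<longleftrightarrow> equiv (dcar D) \<rho> \<and>
     (\<forall>(a,b)\<in>\<rho>. \<forall>(c,d)\<in>\<rho>. (dplus D a c, dplus D b d) \<in> \<rho> \<and> (dtimes D a c, dtimes D b d) \<in> \<rho>)"

text \<open>Downward closure of A modulo \<rho> (as a saturated set of elements).\<close>
definition down_mod :: "'a dioid \<Rightarrow> 'a rel \<Rightarrow> 'a set \<Rightarrow> 'a set" where
  "down_mod D \<rho> A = {x \<in> dcar D. \<exists>a\<in>A. (dplus D x a, a) \<in> \<rho>}"

definition R_cong :: "'a dioid \<Rightarrow> 'a rel \<Rightarrow> bool" where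
  "R_cong D \<rho> \<longleftrightarrow> semiring_cong D \<rho> \<and>
     (\<forall>A\<in>rat D. \<forall>B\<in>rat D. down_mod D \<rho> A = down_mod D \<rho> B \<longrightarrow> (dSup D A, dSup D B) \<in> \<rho>)"

definition least_R_cong :: "'a dioid \<Rightarrow> 'a rel \<Rightarrow> 'a rel" where
  "least_R_cong D R0 = \<Inter>{\<rho>. R_cong D \<rho> \<and> R0 \<subseteq> \<rho>}"

definition quot :: "'a dioid \<Rightarrow> 'a rel \<Rightarrow> 'a set dioid" where
  "quot D \<rho> = \<lparr> dcar = dcar D // \<rho>,
     dplus = (\<lambda>X Y. \<Union>x\<in>X. \<Union>y\<in>Y. \<rho> `` {dplus D x y}),
     dtimes = (\<lambda>X Y. \<Union>x\<in>X. \<Union>y\<in>Y. \<rho> `` {dtimes D x y}),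
     dzero = \<rho> `` {dzero D},
     dunit = \<rho> `` {dunit D} \<rparr>"

definition lconc :: "'x list set \<Rightarrow> 'x list set \<Rightarrow> 'x list set" where
  "lconc L M = {u @ v | u v. u \<in> L \<and> v \<in> M}"

inductive_set lstar :: "'x list set \<Rightarrow> 'x list set" for L where
  lstar_nil: "[] \<in> lstar L"
| lstar_step: "u \<in> L \<Longrightarrow> v \<in> lstar L \<Longrightarrow> u @ v \<in> lstar L"

inductive_set reglang :: "'x set \<Rightarrow> 'x list set set" for \<Sigma> where
  rl_empty: "{} \<in> reglang \<Sigma>"
| rl_eps: "{[]} \<in> reglang \<Sigma>"
| rl_letter: "x \<in> \<Sigma> \<Longrightarrow> {[x]} \<in> reglang \<Sigma>"
| rl_un: "L \<in> reglang \<Sigma> \<Longrightarrow> M \<in> reglang \<Sigma> \<Longrightarrow> L \<union> M \<in> reglang \<Sigma>"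
| rl_conc: "L \<in> reglang \<Sigma> \<Longrightarrow> M \<in> reglang \<Sigma> \<Longrightarrow> lconc L M \<in> reglang \<Sigma>"
| rl_star: "L \<in> reglang \<Sigma> \<Longrightarrow> lstar L \<in> reglang \<Sigma>"

definition RL :: "'x set \<Rightarrow> 'x list set dioid" where
  "RL \<Sigma> = \<lparr> dcar = reglang \<Sigma>, dplus = (\<union>), dtimes = lconc, dzero = {}, dunit = {[]} \<rparr>"

datatype delta = p0 | p1 | q0 | q1

definition C2_rel :: "(delta list set \<times> delta list set) set" where
  "C2_rel = {({[p0, q0]}, {[]}), ({[p1, q1]}, {[]}), ({[p0, q1]}, {}), ({[p1, q0]}, {})}"

definition C2_rho :: "delta list set rel" where
  "C2_rho = least_R_cong (RL UNIV) C2_rel"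

definition C2' :: "delta list set set dioid" where
  "C2' = quot (RL UNIV) C2_rho"

definition gen :: "delta \<Rightarrow> delta list set set" where
  "gen x = C2_rho `` {{[x]}}"

text \<open>Relations expressing that the letter embedding via emb is a morphism
  preserving 0, 1, +, \<cdot> and Kleene star (= suprema of regular sets).\<close>
definition hom_rel :: "'a dioid \<Rightarrow> ('a \<Rightarrow> 'x) \<Rightarrow> ('x list set \<times> 'x list set) set" where
  "hom_rel D emb =
     {({[emb (dplus D a b)]}, {[emb a], [emb b]}) | a b. a \<in> dcar D \<and> b \<in> dcar D} \<union>
     {({[emb (dtimes D a b)]}, {[emb a, emb b]}) | a b. a \<in> dcar D \<and> b \<in> dcar D} \<union>
     {({[emb (dzero D)]}, {}), ({[emb (dunit D)]}, {[]})} \<union>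
     {({[emb (dstar D a)]}, lstar {[emb a]}) | a. a \<in> dcar D}"

definition comm_rel :: "'a dioid \<Rightarrow> 'b dioid \<Rightarrow> (('a + 'b) list set \<times> ('a + 'b) list set) set" where
  "comm_rel A B = {({[Inl a, Inr b]}, {[Inr b, Inl a]}) | a b. a \<in> dcar A \<and> b \<in> dcar B}"

definition tensor_rho :: "'a dioid \<Rightarrow> 'b dioid \<Rightarrow> ('a + 'b) list set rel" where
  "tensor_rho A B = least_R_cong (RL (dcar A <+> dcar B))
      (hom_rel A Inl \<union> hom_rel B Inr \<union> comm_rel A B)"

definition tensor :: "'a dioid \<Rightarrow> 'b dioid \<Rightarrow> ('a + 'b) list set set dioid" where
  "tensor A B = quot (RL (dcar A <+> dcar B)) (tensor_rho A B)"

definition inL :: "'a dioid \<Rightarrow> 'b dioid \<Rightarrow> 'a \<Rightarrow> ('a + 'b) list set set" where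
  "inL A B a = tensor_rho A B `` {{[Inl a]}}"

definition inR :: "'a dioid \<Rightarrow> 'b dioid \<Rightarrow> 'b \<Rightarrow> ('a + 'b) list set set" where
  "inR A B b = tensor_rho A B `` {{[Inr b]}}"

definition ZC :: "'k dioid \<Rightarrow> ('k + delta list set set) list set set set" where
  "ZC K = {x \<in> dcar (tensor K C2'). \<forall>c\<in>dcar C2'.
      dtimes (tensor K C2') x (inR K C2' c) = dtimes (tensor K C2') (inR K C2' c) x}"

fun msum :: "'a dioid \<Rightarrow> nat \<Rightarrow> (nat \<Rightarrow> 'a) \<Rightarrow> 'a" where
  "msum D 0 g = dzero D"
| "msum D (Suc n) g = dplus D (msum D n g) (g n)"

definition mmul :: "'a dioid \<Rightarrow> nat \<Rightarrow> (nat \<Rightarrow> nat \<Rightarrow> 'a) \<Rightarrow> (nat \<Rightarrow> nat \<Rightarrow> 'a) \<Rightarrow> nat \<Rightarrow> nat \<Rightarrow> 'a" where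
  "mmul D n M N = (\<lambda>i j. msum D n (\<lambda>k. dtimes D (M i k) (N k j)))"

definition madd :: "'a dioid \<Rightarrow> (nat \<Rightarrow> nat \<Rightarrow> 'a) \<Rightarrow> (nat \<Rightarrow> nat \<Rightarrow> 'a) \<Rightarrow> nat \<Rightarrow> nat \<Rightarrow> 'a" where
  "madd D M N = (\<lambda>i j. dplus D (M i j) (N i j))"

definition mleq :: "'a dioid \<Rightarrow> nat \<Rightarrow> (nat \<Rightarrow> nat \<Rightarrow> 'a) \<Rightarrow> (nat \<Rightarrow> nat \<Rightarrow> 'a) \<Rightarrow> bool" where
  "mleq D n M N \<longleftrightarrow> (\<forall>i<n. \<forall>j<n. dleq D (M i j) (N i j))"

text \<open>Standard (Kozen/Conway) block definition of the star of a matrix: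
  split off the top-left 1x1 block a, with b (row), c (column), E (rest).\<close>
fun mat_star :: "'a dioid \<Rightarrow> nat \<Rightarrow> (nat \<Rightarrow> nat \<Rightarrow> 'a) \<Rightarrow> nat \<Rightarrow> nat \<Rightarrow> 'a" where
  "mat_star D 0 M = (\<lambda>i j. dzero D)"
| "mat_star D (Suc n) M =
     (let a = M 0 0; b = (\<lambda>j. M 0 (Suc j)); c = (\<lambda>i. M (Suc i) 0);
          E = mat_star D n (\<lambda>i j. M (Suc i) (Suc j));
          bE = (\<lambda>j. msum D n (\<lambda>k. dtimes D (b k) (E k j)));
          Ec = (\<lambda>i. msum D n (\<lambda>k. dtimes D (E i k) (c k)));
          f = dstar D (dplus D a (msum D n (\<lambda>k. dtimes D (b k) (Ec k))))
      in (\<lambda>i j. if i = 0 then (if j = 0 then f else dtimes D f (bE (j - 1)))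
               else if j = 0 then dtimes D (Ec (i - 1)) f
               else dplus D (E (i - 1) (j - 1)) (dtimes D (dtimes D (Ec (i - 1)) f) (bE (j - 1)))))"

definition bil :: "'a dioid \<Rightarrow> nat \<Rightarrow> (nat \<Rightarrow> 'a) \<Rightarrow> (nat \<Rightarrow> nat \<Rightarrow> 'a) \<Rightarrow> (nat \<Rightarrow> 'a) \<Rightarrow> 'a" where
  "bil D n S M F = msum D n (\<lambda>i. dtimes D (S i) (msum D n (\<lambda>j. dtimes D (M i j) (F j))))"

end

theory Submission
  imports Defs
begin

text \<open>Elements of the tensor product are classes of regular languages, and because the congruence
  is continuous, inequalities between them can be checked one word at a time. By Kleene's theorem
  \<open>\<phi> = S A\<^sup>* F\<close> with \<open>A = U + X + V\<close>, where the entries of \<open>X\<close> are languages over \<open>K\<close>. Take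
  \<open>N = p\<^sub>0 (U p\<^sub>1 + X + q\<^sub>1 V)\<^sup>* q\<^sub>0\<close>: every word of \<open>N\<close> vanishes or reduces to a word over \<open>K\<close>,
  so \<open>N\<close> is the sum of the balanced paths of \<open>A\<close> and commutes with the brackets. Hence
  \<open>1 + X + N N + U N V \<le> N \<le> A\<^sup>*\<close>, which gives \<open>A\<^sup>* = (N V)\<^sup>* N (U N)\<^sup>*\<close> and
  \<open>(U N V + N)\<^sup>* \<le> N\<close>, while \<open>y \<ge> (U y V + N)\<^sup>*\<close> trivially implies \<open>y \<ge> N\<close>.\<close>

subsection \<open>Regular languages\<close>

text \<open>Balanced paths form a context-free set, so in general no regular language over
  \<open>K\<close> collects them. The brackets act as a stack: as in the Chomsky-Schuetzenberger
  theorem, a regular language with brackets represents that set, and the relations between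
  \<open>p_i\<close> and \<open>q_j\<close> do the filtering. The plain sandwich
  \<open>p\<^sub>0 A\<^sup>* q\<^sub>0\<close> filters badly: if an edge of \<open>V\<close> carries
  \<open>q\<^sub>0\<close>, the word \<open>p\<^sub>0 q\<^sub>0 q\<^sub>0\<close> reduces to
  \<open>q\<^sub>0\<close>, which is neither zero nor a word over \<open>K\<close>. The relations
  give no rule for products \<open>q_i p_j\<close>, so \<open>N N \<le> N\<close> is not a
  cancellation of the inner end markers; it rests on surviving words being scalars, which move
  through the next marker. Words of \<open>N\<close> are not words of \<open>A\<^sup>*\<close>
  either, so their reduction carries along a run of \<open>A\<close> with the same value. Finally,
  the alphabet of the tensor product has a letter for every element of \<open>C2'\<close>, and each
  must be spelled by the four generators before an automaton with the prescribed \<open>U\<close>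
  and \<open>V\<close> can be built.\<close>

lemma RL_simps [simp]:
  "dcar (RL \<Sigma>) = reglang \<Sigma>" "dplus (RL \<Sigma>) = (\<union>)" "dtimes (RL \<Sigma>) = lconc"
  "dzero (RL \<Sigma>) = {}" "dunit (RL \<Sigma>) = {[]}"
  by (auto simp: RL_def)

lemma lconcI: "u \<in> L \<Longrightarrow> v \<in> M \<Longrightarrow> u @ v \<in> lconc L M"
  by (auto simp: lconc_def)

lemma lconcE:
  assumes "w \<in> lconc L M" obtains u v where "w = u @ v" "u \<in> L" "v \<in> M"
  using assms by (auto simp: lconc_def)

lemma lconc_singleton [simp]: "lconc {u} {v} = {u @ v}"
  and lconc_empty [simp]: "lconc {} L = {}" "lconc L {} = {}"
  and lconc_eps [simp]: "lconc {[]} L = L" "lconc L {[]} = L"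
  by (auto simp: lconc_def)

lemma reglang_lists: "L \<in> reglang \<Sigma> \<Longrightarrow> L \<subseteq> lists \<Sigma>"
proof (induction rule: reglang.induct)
  case (rl_star L)
  have "w \<in> lists \<Sigma>" if "w \<in> lstar L" for w
    using that rl_star.IH by induction auto
  then show ?case by blast
next
  case (rl_conc L M)
  then show ?case by (force simp: lconc_def)
qed auto

lemma reglang_word: "{w} \<in> reglang \<Sigma> \<longleftrightarrow> w \<in> lists \<Sigma>"
proof
  assume "w \<in> lists \<Sigma>"
  then show "{w} \<in> reglang \<Sigma>"
  proof (induction w)
    case (Cons a w)
    then have "lconc {[a]} {w} \<in> reglang \<Sigma>"
      by (intro reglang.intros) auto
    then show ?case by simp
  qed (auto intro: reglang.intros)
qed (use reglang_lists in blast)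

lemma reglang_mono: "L \<in> reglang \<Sigma> \<Longrightarrow> \<Sigma> \<subseteq> \<Sigma>' \<Longrightarrow> L \<in> reglang \<Sigma>'"
  by (induction rule: reglang.induct) (auto intro: reglang.intros)

lemma reglang_insert: "w \<in> lists \<Sigma> \<Longrightarrow> M \<in> reglang \<Sigma> \<Longrightarrow> insert w M \<in> reglang \<Sigma>"
  using reglang.rl_un[of "{w}" \<Sigma> M] by (simp add: reglang_word)

lemma Union_mstar_RL: "\<Union>(mstar (RL \<Sigma>) A) = lstar (\<Union>A)"
proof (intro set_eqI iffI)
  fix w assume "w \<in> \<Union>(mstar (RL \<Sigma>) A)"
  then obtain X where "X \<in> mstar (RL \<Sigma>) A" "w \<in> X" by blast
  then show "w \<in> lstar (\<Union>A)"
    by (induction arbitrary: w rule: mstar.induct) (auto simp: lconc_def intro: lstar.intros)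
next
  fix w assume "w \<in> lstar (\<Union>A)"
  then show "w \<in> \<Union>(mstar (RL \<Sigma>) A)"
  proof induction
    case lstar_nil
    then show ?case using mstar_unit[where D = "RL \<Sigma>"] by auto
  next
    case (lstar_step u v)
    then obtain X Y where "X \<in> A" "u \<in> X" "Y \<in> mstar (RL \<Sigma>) A" "v \<in> Y" by blast
    then have "lconc X Y \<in> mstar (RL \<Sigma>) A" "u @ v \<in> lconc X Y"
      using mstar_step[of X A Y "RL \<Sigma>"] by (auto intro: lconcI)
    then show ?case by blast
  qed
qed

text \<open>\<open>\<Union>\<close> turns each clause of \<open>rat\<close> over
  \<open>RL \<Sigma>\<close> into closure properties of \<open>reglang\<close>. So suprema of
  rational sets are plain unions, and these remain regular.\<close>

lemma Union_rat_RL: "A \<in> rat (RL \<Sigma>) \<Longrightarrow> \<Union>A \<in> reglang \<Sigma>"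
proof (induction rule: rat.induct)
  case (rat_fin A)
  from rat_fin(1) have "A \<subseteq> reglang \<Sigma> \<Longrightarrow> \<Union>A \<in> reglang \<Sigma>"
    by induction (auto intro: reglang.intros)
  with rat_fin(2) show ?case by simp
next
  case (rat_mul A B)
  have "\<Union>(setmul (RL \<Sigma>) A B) = lconc (\<Union>A) (\<Union>B)"
    by (auto simp: setmul_def lconc_def)
  then show ?case using rat_mul.IH by (auto intro: reglang.intros)
qed (auto simp: Union_mstar_RL intro: reglang.intros)

lemma dleq_RL [simp]: "dleq (RL \<Sigma>) L M \<longleftrightarrow> L \<subseteq> M"
  by (auto simp: dleq_def)

lemma dSup_RL: "\<Union>A \<in> reglang \<Sigma> \<Longrightarrow> dSup (RL \<Sigma>) A = \<Union>A"
  unfolding dSup_def by (rule the_equality) (auto simp: is_lub_def)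

lemma dstar_RL: "L \<in> reglang \<Sigma> \<Longrightarrow> dstar (RL \<Sigma>) L = lstar L"
  by (simp add: dstar_def dSup_RL Union_mstar_RL reglang.rl_star)

lemma dstar_reglang: "L \<in> reglang \<Sigma> \<Longrightarrow> dstar (RL \<Sigma>) L \<in> reglang \<Sigma>"
  by (simp add: dstar_RL reglang.rl_star)

text \<open>This presents a regular language as the supremum of a rational set of one-word
  languages, the shape to which the continuity clause of \<open>R_cong\<close> applies.\<close>

lemma singletons_rat: "L \<in> reglang \<Sigma> \<Longrightarrow> (\<lambda>w. {w}) ` L \<in> rat (RL \<Sigma>)"
proof (induction rule: reglang.induct)
  case (rl_conc L M)
  have "(\<lambda>w. {w}) ` lconc L M = setmul (RL \<Sigma>) ((\<lambda>w. {w}) ` L) ((\<lambda>w. {w}) ` M)"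
    by (auto simp: lconc_def setmul_def image_def)
  then show ?case using rl_conc.IH by (auto intro: rat.intros)
next
  case (rl_star L)
  have "(\<lambda>w. {w}) ` lstar L = mstar (RL \<Sigma>) ((\<lambda>w. {w}) ` L)"
  proof (intro set_eqI iffI)
    fix X assume "X \<in> (\<lambda>w. {w}) ` lstar L"
    then obtain w where "w \<in> lstar L" "X = {w}" by blast
    then show "X \<in> mstar (RL \<Sigma>) ((\<lambda>w. {w}) ` L)"
    proof (induction arbitrary: X rule: lstar.induct)
      case lstar_nil
      then show ?case using mstar_unit[where D = "RL \<Sigma>"] by simp
    next
      case (lstar_step u v)
      then show ?case using mstar_step[of "{u}" "(\<lambda>w. {w}) ` L" "{v}" "RL \<Sigma>"] by simp
    qed
  next
    fix X assume "X \<in> mstar (RL \<Sigma>) ((\<lambda>w. {w}) ` L)"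
    then show "X \<in> (\<lambda>w. {w}) ` lstar L"
      by induction (auto intro: lstar.intros)
  qed
  then show ?case using rl_star.IH by (auto intro: rat.intros)
next
  case rl_eps
  show ?case by (rule rat_fin) (auto intro: reglang.intros)
next
  case (rl_letter x)
  then show ?case by (intro rat_fin) (auto intro: reglang.intros)
qed (auto simp: image_Un intro: rat.intros)

subsection \<open>Matrices of languages\<close>

text \<open>The words spelled along paths through the vertices below \<open>n\<close>. Labels are
  whole words, and the way a word is cut into labels is not recorded.\<close>

inductive run :: "nat \<Rightarrow> (nat \<Rightarrow> nat \<Rightarrow> 'x list set) \<Rightarrow> nat \<Rightarrow> 'x list \<Rightarrow> nat \<Rightarrow> bool" for n M where
  run_nil: "i < n \<Longrightarrow> run n M i [] i"
| run_step: "i < n \<Longrightarrow> k < n \<Longrightarrow> u \<in> M i k \<Longrightarrow> run n M k v j \<Longrightarrow> run n M i (u @ v) j"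

lemma run_less: "run n M i w j \<Longrightarrow> i < n \<and> j < n"
  by (induction rule: run.induct) auto

lemma run_append: "run n M i u k \<Longrightarrow> run n M k v j \<Longrightarrow> run n M i (u @ v) j"
  by (induction rule: run.induct) (auto intro: run.intros)

lemma run_single: "i < n \<Longrightarrow> j < n \<Longrightarrow> u \<in> M i j \<Longrightarrow> run n M i u j"
  using run_step[of i n j u M "[]" j] by (simp add: run_nil)

lemma run_Suc:
  "run n (\<lambda>i j. M (Suc i) (Suc j)) i w j \<Longrightarrow> run (Suc n) M (Suc i) w (Suc j)"
  by (induction rule: run.induct) (auto intro: run.intros)

lemma run_lstar: "u \<in> lstar L \<Longrightarrow> i < n \<Longrightarrow> (\<And>v. v \<in> L \<Longrightarrow> run n M i v i) \<Longrightarrow> run n M i u i"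
  by (induction rule: lstar.induct) (auto intro: run.intros run_append)

lemma msum_RL: "msum (RL \<Sigma>) n g = (\<Union>k<n. g k)"
  by (induction n) (auto simp: less_Suc_eq)

lemma mmul_RL: "w \<in> mmul (RL \<Sigma>) n M N i j \<longleftrightarrow> (\<exists>k<n. \<exists>u\<in>M i k. \<exists>v\<in>N k j. w = u @ v)"
  by (auto simp: mmul_def msum_RL lconc_def)

lemma msum_reglang: "(\<And>k. g k \<in> reglang \<Sigma>) \<Longrightarrow> msum (RL \<Sigma>) n g \<in> reglang \<Sigma>"
  by (induction n) (auto intro: reglang.intros)

lemma mmul_reglang:
  "(\<And>i j. M i j \<in> reglang \<Sigma>) \<Longrightarrow> (\<And>i j. N i j \<in> reglang \<Sigma>) \<Longrightarrow> mmul (RL \<Sigma>) n M N i j \<in> reglang \<Sigma>"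
  by (auto simp: mmul_def intro!: msum_reglang reglang.intros)

lemma mat_star_reglang:
  "(\<And>i j. M i j \<in> reglang \<Sigma>) \<Longrightarrow> mat_star (RL \<Sigma>) n M i j \<in> reglang \<Sigma>"
proof (induction n arbitrary: M i j)
  case (Suc n)
  note E = Suc.IH[of "\<lambda>i j. M (Suc i) (Suc j)", OF Suc.prems]
  show ?case
    by (auto simp: Let_def Suc.prems E intro!: reglang.intros msum_reglang dstar_reglang)
qed (auto intro: reglang.intros)

text \<open>The block recursion eliminates vertex 0: \<open>f\<close> collects the closed paths at
  0, cut at each return, while \<open>Ec\<close> and \<open>bE\<close> lead to 0 and away from it
  through the other vertices only. Soundness composes paths; completeness is an induction on the
  run.\<close>

lemma mat_star_RL:
  assumes "\<And>i j. M i j \<in> reglang \<Sigma>" "i < n" "j < n"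
  shows "mat_star (RL \<Sigma>) n M i j = {w. run n M i w j}"
  using assms
proof (induction n arbitrary: M i j)
  case (Suc n)
  let ?M' = "\<lambda>i j. M (Suc i) (Suc j)"
  let ?E = "mat_star (RL \<Sigma>) n ?M'"
  define bE where "bE = (\<lambda>j. \<Union>k<n. lconc (M 0 (Suc k)) (?E k j))"
  define Ec where "Ec = (\<lambda>i. \<Union>k<n. lconc (?E i k) (M (Suc k) 0))"
  define bEc where "bEc = (\<Union>k<n. lconc (M 0 (Suc k)) (Ec k))"
  define f where "f = lstar (M 0 0 \<union> bEc)"
  have E: "?E i j = {w. run n ?M' i w j}" if "i < n" "j < n" for i j
    using Suc.IH[of ?M'] Suc.prems(1) that by blast
  have reg: "?E i j \<in> reglang \<Sigma>" for i j
    by (intro mat_star_reglang Suc.prems)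
  have Ec_reg: "Ec i \<in> reglang \<Sigma>" for i
    unfolding Ec_def msum_RL[where \<Sigma> = \<Sigma>, symmetric] by (intro msum_reglang reglang.intros reg Suc.prems)
  have "bEc \<in> reglang \<Sigma>"
    unfolding bEc_def msum_RL[where \<Sigma> = \<Sigma>, symmetric] by (intro msum_reglang reglang.intros Ec_reg Suc.prems)
  then have f: "dstar (RL \<Sigma>) (M 0 0 \<union> bEc) = f"
    unfolding f_def by (intro dstar_RL reglang.intros Suc.prems)
  let ?S = "\<lambda>i j. if i = 0 then (if j = 0 then f else lconc f (bE (j - 1)))
     else if j = 0 then lconc (Ec (i - 1)) f
     else ?E (i - 1) (j - 1) \<union> lconc (lconc (Ec (i - 1)) f) (bE (j - 1))"
  have S: "mat_star (RL \<Sigma>) (Suc n) M = ?S"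
    by (simp add: Let_def msum_RL bE_def Ec_def bEc_def flip: f cong: if_cong)
  have run_E: "run (Suc n) M (Suc i) w (Suc j)" if "w \<in> ?E i j" "i < n" "j < n" for i j w
    using that E run_Suc by fastforce
  have run_bE: "run (Suc n) M 0 w (Suc j)" if "w \<in> bE j" "j < n" for j w
    using that run_E unfolding bE_def by (fastforce elim!: lconcE intro: run_step)
  have run_Ec: "run (Suc n) M (Suc i) w 0" if "w \<in> Ec i" "i < n" for i w
    using that run_E unfolding Ec_def by (fastforce elim!: lconcE intro: run_append run_single)
  have "run (Suc n) M 0 w 0" if "w \<in> bEc" for w
    using that run_Ec unfolding bEc_def by (fastforce elim!: lconcE intro: run_step)
  then have run_f: "run (Suc n) M 0 w 0" if "w \<in> f" for w
    using that unfolding f_def by (elim run_lstar) (auto intro: run_single)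
  have sound: "w \<in> ?S i j \<Longrightarrow> i < Suc n \<Longrightarrow> j < Suc n \<Longrightarrow> run (Suc n) M i w j" for i j w
    by (cases i; cases j)
      (auto elim!: lconcE intro: run_f run_append[OF run_f run_bE] run_append[OF run_Ec run_f] run_E
        run_append[OF run_append[OF run_Ec run_f] run_bE])
  \<comment> \<open>\<open>r j\<close> is the tail of a path after its last visit to vertex 0, and
    \<open>e i j\<close> a path that never visits 0. With them column 0 and the other columns get
    the same shape in \<open>S0\<close> and \<open>S1\<close>.\<close>
  define r where "r j = (case j of 0 \<Rightarrow> {[]} | Suc j \<Rightarrow> bE j)" for j
  define e where "e i j = (case j of 0 \<Rightarrow> {} | Suc j \<Rightarrow> ?E i j)" for i j
  have S0: "?S 0 j = lconc f (r j)" for j by (cases j) (auto simp: r_def)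
  have S1: "?S (Suc i) j = e i j \<union> lconc (lconc (Ec i) f) (r j)" for i j
    by (cases j) (auto simp: r_def e_def)
  have nil_f: "[] \<in> f" unfolding f_def by (rule lstar_nil)
  have step_e: "u @ v \<in> e i j" if "u \<in> ?M' i k" "v \<in> e k j" "i < n" "k < n" "j < Suc n" for i j k u v
    using that by (auto simp: e_def E less_Suc_eq_0_disj intro: run_step)
  have step_E: "u @ v \<in> ?E i j" if "u \<in> ?M' i k" "v \<in> ?E k j" "i < n" "k < n" "j < n" for i j k u v
    using that by (auto simp: E intro: run_step)
  have step_Ec: "u @ v \<in> Ec i" if "u \<in> ?M' i k" "v \<in> Ec k" "i < n" "k < n" for i k u v
    using that step_E unfolding Ec_def by (fastforce elim!: lconcE intro: lconcI simp flip: append_assoc)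
  have step_c: "u \<in> Ec i" if "u \<in> M (Suc i) 0" "i < n" for i u
    using that lconcI[of "[]" "?E i i" u] unfolding Ec_def by (fastforce simp: E intro: run_nil)
  have step_r: "u @ v \<in> r j" if "u \<in> M 0 (Suc k)" "v \<in> e k j" "k < n" "j < Suc n" for k j u v
    using that by (auto simp: r_def e_def bE_def split: nat.splits intro: lconcI)
  have step_f: "u @ v \<in> f" if "u \<in> M 0 0" "v \<in> f" for u v
    using that unfolding f_def by (auto intro: lstar.intros)
  have step_bf: "u @ v @ x \<in> f" if "u \<in> M 0 (Suc k)" "v \<in> Ec k" "k < n" "x \<in> f" for u v x k
    using that lstar_step[of "u @ v" "M 0 0 \<union> bEc" x] unfolding f_def bEc_def
    by (auto intro: lconcI)
  \<comment> \<open>The block matrix absorbs an edge on its left. As its diagonal contains the empty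
    word, induction then puts every run into it.\<close>
  have step: "u @ w \<in> ?S i j" if "u \<in> M i k" "w \<in> ?S k j" "i < Suc n" "k < Suc n" "j < Suc n" for i j k u w
  proof (cases i)
    case [simp]: 0
    show ?thesis
    proof (cases k)
      case [simp]: 0
      have "w \<in> lconc f (r j)"
        using that(2) unfolding \<open>k = 0\<close> S0 .
      then obtain x y where "w = x @ y" "x \<in> f" "y \<in> r j"
        by (rule lconcE)
      then show ?thesis using that step_f unfolding \<open>i = 0\<close> S0
        by (metis append_assoc lconcI 0)
    next
      case [simp]: (Suc k')
      from that(2) consider "w \<in> e k' j" | "w \<in> lconc (lconc (Ec k') f) (r j)"
        unfolding Suc S1 by blast
      then show ?thesis
      proof cases
        case 1
        then have "u @ w \<in> r j" using step_r that by auto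
        then show ?thesis unfolding \<open>i = 0\<close> S0 using lconcI[OF nil_f] by fastforce
      next
        case 2
        then obtain x y z where "w = x @ y @ z" "x \<in> Ec k'" "y \<in> f" "z \<in> r j"
          by (auto elim!: lconcE)
        then show ?thesis unfolding \<open>i = 0\<close> S0
          using step_bf[of u k' x y] lconcI[of "u @ x @ y" f z] that by auto
      qed
    qed
  next
    case [simp]: (Suc i')
    show ?thesis
    proof (cases k)
      case [simp]: 0
      have "w \<in> lconc f (r j)"
        using that(2) unfolding \<open>k = 0\<close> S0 .
      then obtain x y where "w = x @ y" "x \<in> f" "y \<in> r j"
        by (rule lconcE)
      then show ?thesis using that step_c[of u i'] unfolding \<open>i = _\<close> S1
        by (auto intro!: lconcI simp flip: append_assoc)
    next
      case [simp]: (Suc k')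
      from that(2) consider "w \<in> e k' j" | "w \<in> lconc (lconc (Ec k') f) (r j)"
        unfolding Suc S1 by blast
      then show ?thesis
      proof cases
        case 1
        then show ?thesis unfolding \<open>i = _\<close> S1 using step_e[of u i' k' w j] that by auto
      next
        case 2
        then obtain x y z where "w = x @ y @ z" "x \<in> Ec k'" "y \<in> f" "z \<in> r j"
          by (auto elim!: lconcE)
        then show ?thesis unfolding \<open>i = _\<close> S1
          using step_Ec[of u i' k' x] that by (auto intro!: lconcI simp flip: append_assoc)
      qed
    qed
  qed
  have "w \<in> ?S i j" if "run (Suc n) M i w j" for w i j
    using that
  proof (induction rule: run.induct)
    case (run_nil i)
    then show ?case using nil_f by (cases i) (auto simp: E intro: run.run_nil)
  next
    case (run_step i k u v j)
    then show ?case using step run_less by blast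
  qed
  with sound show ?case unfolding S using Suc.prems by blast
qed simp

subsection \<open>Quotients of the algebra of regular languages\<close>

lemma semiring_congD:
  assumes "semiring_cong D \<rho>"
  shows "equiv (dcar D) \<rho>"
    "(a, b) \<in> \<rho> \<Longrightarrow> (c, d) \<in> \<rho> \<Longrightarrow> (dplus D a c, dplus D b d) \<in> \<rho>"
    "(a, b) \<in> \<rho> \<Longrightarrow> (c, d) \<in> \<rho> \<Longrightarrow> (dtimes D a c, dtimes D b d) \<in> \<rho>"
  using assms unfolding semiring_cong_def by fast+

text \<open>Refining a congruence keeps equality of downward closures, because \<open>A\<close> and \<open>B\<close> are
  mutually cofinal modulo the finer congruence. So the intersection is again an R-congruence.\<close>
lemma down_mod_RL_mono:
  assumes A: "A \<in> rat (RL \<Sigma>)" "A \<subseteq> reglang \<Sigma>"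
    and sub: "\<rho> \<subseteq> \<sigma>" and \<rho>: "equiv (reglang \<Sigma>) \<rho>" and \<sigma>: "semiring_cong (RL \<Sigma>) \<sigma>"
    and eq: "down_mod (RL \<Sigma>) \<rho> A = down_mod (RL \<Sigma>) \<rho> B"
  shows "down_mod (RL \<Sigma>) \<sigma> A \<subseteq> down_mod (RL \<Sigma>) \<sigma> B"
proof
  fix x assume "x \<in> down_mod (RL \<Sigma>) \<sigma> A"
  then obtain a where a: "x \<in> reglang \<Sigma>" "a \<in> A" "(x \<union> a, a) \<in> \<sigma>"
    by (auto simp: down_mod_def)
  with A \<rho> have "(a, a) \<in> \<rho>" "a \<in> reglang \<Sigma>"
    by (auto simp: equiv_def refl_on_def)
  with a(2) have "a \<in> down_mod (RL \<Sigma>) \<rho> A"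
    unfolding down_mod_def by force
  with eq obtain b where b: "b \<in> B" "(a \<union> b, b) \<in> \<sigma>"
    using sub by (auto simp: down_mod_def)
  note eqv = semiring_congD(1)[OF \<sigma>]
  have trans: "(p, r) \<in> \<sigma>" if "(p, q) \<in> \<sigma>" "(q, r) \<in> \<sigma>" for p q r
    using that eqv by (meson equivE transE)
  have sym: "(q, p) \<in> \<sigma>" if "(p, q) \<in> \<sigma>" for p q
    using that eqv by (meson equivE symE)
  have refl: "(p, p) \<in> \<sigma>" if "(p, q) \<in> \<sigma>" for p q
    using that trans sym by blast
  have "(x, x) \<in> \<sigma>"
    using eqv a(1) by (auto simp: equiv_def refl_on_def)
  have "(x \<union> b, x \<union> (a \<union> b)) \<in> \<sigma>"
    using semiring_congD(2)[OF \<sigma> \<open>(x, x) \<in> \<sigma>\<close> sym[OF b(2)]] by simp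
  moreover have "(x \<union> (a \<union> b), a \<union> b) \<in> \<sigma>"
    using semiring_congD(2)[OF \<sigma> a(3) refl[OF sym[OF b(2)]]] by (simp add: Un_assoc)
  ultimately have "(x \<union> b, b) \<in> \<sigma>"
    using b(2) trans by blast
  with a(1) b(1) show "x \<in> down_mod (RL \<Sigma>) \<sigma> B"
    by (auto simp: down_mod_def)
qed

lemma rat_RL_subset: "A \<in> rat (RL \<Sigma>) \<Longrightarrow> A \<subseteq> reglang \<Sigma>"
proof (induction rule: rat.induct)
  case (rat_star A)
  have "X \<in> reglang \<Sigma>" if "X \<in> mstar (RL \<Sigma>) A" for X
    using that rat_star.IH by induction (auto intro: reglang.intros)
  then show ?case by blast
qed (auto simp: setmul_def intro: reglang.rl_conc)

lemma R_cong_Inter: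
  assumes "\<R> \<noteq> {}" and R: "\<And>\<rho>. \<rho> \<in> \<R> \<Longrightarrow> R_cong (RL \<Sigma>) \<rho>"
  shows "R_cong (RL \<Sigma>) (\<Inter>\<R>)"
proof -
  have sc: "semiring_cong (RL \<Sigma>) \<rho>" if "\<rho> \<in> \<R>" for \<rho>
    using R that by (simp add: R_cong_def)
  have eqv: "equiv (reglang \<Sigma>) \<rho>" if "\<rho> \<in> \<R>" for \<rho>
    using semiring_congD(1)[OF sc[OF that]] by simp
  have e: "equiv (reglang \<Sigma>) (\<Inter>\<R>)"
  proof (rule equivI)
    show "\<Inter>\<R> \<subseteq> reglang \<Sigma> \<times> reglang \<Sigma>"
    proof -
      obtain \<rho> where "\<rho> \<in> \<R>" using assms(1) by blast
      then show ?thesis using equiv_type[OF eqv] by blast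
    qed
    show "refl_on (reglang \<Sigma>) (\<Inter>\<R>)"
      using eqv by (auto simp: equiv_def refl_on_def)
    show "sym (\<Inter>\<R>)"
      using eqv by (auto simp: equiv_def sym_def)
    show "trans (\<Inter>\<R>)"
    proof (rule transI)
      fix x y z assume "(x, y) \<in> \<Inter>\<R>" "(y, z) \<in> \<Inter>\<R>"
      then show "(x, z) \<in> \<Inter>\<R>"
        using eqv by (meson InterE InterI equivE transE)
    qed
  qed
  moreover have "semiring_cong (RL \<Sigma>) (\<Inter>\<R>)"
    unfolding semiring_cong_def
  proof (intro conjI ballI case_prodI2 InterI)
    show "equiv (dcar (RL \<Sigma>)) (\<Inter>\<R>)" using e by simp
  qed (use semiring_congD(2,3)[OF sc] in auto)
  moreover have "(dSup (RL \<Sigma>) A, dSup (RL \<Sigma>) B) \<in> \<rho>"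
    if "A \<in> rat (RL \<Sigma>)" "B \<in> rat (RL \<Sigma>)" "\<rho> \<in> \<R>"
      "down_mod (RL \<Sigma>) (\<Inter>\<R>) A = down_mod (RL \<Sigma>) (\<Inter>\<R>) B" for A B \<rho>
  proof -
    have "down_mod (RL \<Sigma>) \<rho> A = down_mod (RL \<Sigma>) \<rho> B"
      using down_mod_RL_mono[OF that(1) rat_RL_subset[OF that(1)] _ e sc[OF that(3)] that(4)]
        down_mod_RL_mono[OF that(2) rat_RL_subset[OF that(2)] _ e sc[OF that(3)] that(4)[symmetric]]
        that(3)
      by (simp add: Inter_lower subset_antisym)
    then show ?thesis using R[OF that(3)] that(1,2) by (simp add: R_cong_def)
  qed
  ultimately show ?thesis
    unfolding R_cong_def by blast
qed

text \<open>This keeps the family intersected in \<open>least_R_cong\<close> nonempty; the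
  intersection of the empty family would be \<open>UNIV\<close>, not a relation on regular
  languages.\<close>

lemma R_cong_total: "R_cong (RL \<Sigma>) (reglang \<Sigma> \<times> reglang \<Sigma>)"
  by (auto simp: R_cong_def semiring_cong_def equiv_def refl_on_def sym_def trans_def
      dSup_RL Union_rat_RL intro: reglang.intros)

lemma least_R_cong:
  assumes "R0 \<subseteq> reglang \<Sigma> \<times> reglang \<Sigma>"
  shows "R_cong (RL \<Sigma>) (least_R_cong (RL \<Sigma>) R0)" "R0 \<subseteq> least_R_cong (RL \<Sigma>) R0"
proof -
  show "R_cong (RL \<Sigma>) (least_R_cong (RL \<Sigma>) R0)"
    unfolding least_R_cong_def using R_cong_total assms by (intro R_cong_Inter) auto
  show "R0 \<subseteq> least_R_cong (RL \<Sigma>) R0"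
    by (auto simp: least_R_cong_def)
qed

text \<open>Both \<open>C2'\<close> and \<open>tensor K C2'\<close> are quotients of this kind, so
  the calculus of classes is developed once for both.\<close>

locale regular_quotient =
  fixes \<Sigma> :: "'x set" and \<rho> :: "'x list set rel"
  assumes R_cong: "R_cong (RL \<Sigma>) \<rho>"
begin

abbreviation Q where "Q \<equiv> quot (RL \<Sigma>) \<rho>"

definition cls :: "'x list set \<Rightarrow> 'x list set set" where "cls L = \<rho> `` {L}"

lemma semiring_cong: "semiring_cong (RL \<Sigma>) \<rho>"
  using R_cong by (simp add: R_cong_def)

lemma equiv: "equiv (reglang \<Sigma>) \<rho>"
  using semiring_congD(1)[OF semiring_cong] by simp

lemma cls_eq_iff:
  "L \<in> reglang \<Sigma> \<Longrightarrow> M \<in> reglang \<Sigma> \<Longrightarrow> cls L = cls M \<longleftrightarrow> (L, M) \<in> \<rho>"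
  unfolding cls_def using equiv eq_equiv_class_iff by fastforce

lemma cls_eqI: "(L, M) \<in> \<rho> \<Longrightarrow> cls L = cls M"
  unfolding cls_def using equiv equiv_class_eq by fastforce

text \<open>The default class \<open>{}\<close> is never the class of a regular language, by
  \<open>cls_self\<close>. An equation between classes therefore also transfers regularity, and for
  one-word languages membership in \<open>lists \<Sigma>\<close>.\<close>

lemma cls_nonregular: "L \<notin> reglang \<Sigma> \<Longrightarrow> cls L = {}"
  unfolding cls_def using equiv_type[OF equiv] by blast

lemma cls_self: "L \<in> reglang \<Sigma> \<Longrightarrow> L \<in> cls L"
  unfolding cls_def using equiv by (rule equiv_class_self)

lemma dcar_Q: "dcar Q = cls ` reglang \<Sigma>"
  by (auto simp: quot_def quotient_def cls_def)

lemma dzero_Q: "dzero Q = cls {}" and dunit_Q: "dunit Q = cls {[]}"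
  by (simp_all add: quot_def cls_def)

lemma dplus_Q: "L \<in> reglang \<Sigma> \<Longrightarrow> M \<in> reglang \<Sigma> \<Longrightarrow> dplus Q (cls L) (cls M) = cls (L \<union> M)"
  unfolding quot_def cls_def dioid.simps RL_simps
proof (rule UN_equiv_class2[OF equiv equiv, of "\<lambda>x y. \<rho> `` {x \<union> y}"])
  show "congruent2 \<rho> \<rho> (\<lambda>x y. \<rho> `` {x \<union> y})"
    using semiring_congD(2)[OF semiring_cong]
    by (intro congruent2I' equiv_class_eq[OF equiv]) simp
qed

lemma dtimes_Q: "L \<in> reglang \<Sigma> \<Longrightarrow> M \<in> reglang \<Sigma> \<Longrightarrow> dtimes Q (cls L) (cls M) = cls (lconc L M)"
  unfolding quot_def cls_def dioid.simps RL_simps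
proof (rule UN_equiv_class2[OF equiv equiv, of "\<lambda>x y. \<rho> `` {lconc x y}"])
  show "congruent2 \<rho> \<rho> (\<lambda>x y. \<rho> `` {lconc x y})"
    using semiring_congD(3)[OF semiring_cong]
    by (intro congruent2I' equiv_class_eq[OF equiv]) simp
qed

lemma cls_Un_cong:
  assumes "L \<in> reglang \<Sigma>" "L' \<in> reglang \<Sigma>" "M \<in> reglang \<Sigma>" "M' \<in> reglang \<Sigma>"
    and "cls L = cls L'" "cls M = cls M'"
  shows "cls (L \<union> M) = cls (L' \<union> M')"
  using assms by (metis dplus_Q)

lemma cls_lconc_cong:
  assumes "L \<in> reglang \<Sigma>" "L' \<in> reglang \<Sigma>" "M \<in> reglang \<Sigma>" "M' \<in> reglang \<Sigma>"
    and "cls L = cls L'" "cls M = cls M'"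
  shows "cls (lconc L M) = cls (lconc L' M')"
  using assms by (metis dtimes_Q)

text \<open>A saturation of \<open>M\<close>: for regular \<open>M\<close>, the words whose class
  lies below \<open>cls M\<close> in the quotient order. It serves only as a set of words; no
  regularity of it is claimed.\<close>

definition hull :: "'x list set \<Rightarrow> 'x list set" where
  "hull M = {w \<in> lists \<Sigma>. cls (insert w M) = cls M}"

lemma hull_superset: "M \<in> reglang \<Sigma> \<Longrightarrow> w \<in> M \<Longrightarrow> w \<in> hull M"
  using reglang_lists by (auto simp: hull_def insert_absorb)

lemma hull_lists: "w \<in> hull M \<Longrightarrow> w \<in> lists \<Sigma>"
  by (simp add: hull_def)

text \<open>Continuity: a regular language is the supremum of the rational set of its words, so an
  inequality modulo \<open>\<rho>\<close> can be checked word by word.\<close>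
lemma cls_Un_hull:
  assumes L: "L \<in> reglang \<Sigma>" and M: "M \<in> reglang \<Sigma>" and hull: "L \<subseteq> hull M"
  shows "cls (L \<union> M) = cls M"
proof -
  \<comment> \<open>Adding \<open>M\<close> itself makes \<open>?A\<close> and \<open>{M}\<close>
    cofinal modulo \<rho>, since each \<open>{w}\<close> lies below \<open>M\<close> by hypothesis.
    Their suprema are \<open>L \<union> M\<close> and \<open>M\<close>.\<close>
  let ?A = "(\<lambda>w. {w}) ` L \<union> {M}"
  have A: "?A \<in> rat (RL \<Sigma>)" and B: "{M} \<in> rat (RL \<Sigma>)"
    using L M by (intro rat_un singletons_rat rat_fin; simp)+
  have "down_mod (RL \<Sigma>) \<rho> ?A = down_mod (RL \<Sigma>) \<rho> {M}"
  proof (intro equalityI subsetI)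
    fix x assume "x \<in> down_mod (RL \<Sigma>) \<rho> ?A"
    then obtain a where x: "x \<in> reglang \<Sigma>" "(x \<union> a, a) \<in> \<rho>" "a \<in> ?A"
      unfolding down_mod_def RL_simps by blast
    have a: "a \<in> reglang \<Sigma>"
      using x(3) L M reglang_lists[OF L] by (auto simp: reglang_word)
    have aM: "cls (a \<union> M) = cls M"
      using x(3) hull by (auto simp: hull_def)
    have "cls (x \<union> M) = cls (x \<union> (a \<union> M))"
      using x a M aM by (intro cls_Un_cong) (auto intro: reglang.intros)
    also have "\<dots> = cls (a \<union> M)"
      using cls_Un_cong[of "x \<union> a" a M M] x a M cls_eqI[OF x(2)]
      by (auto simp: Un_assoc intro: reglang.intros)
    finally show "x \<in> down_mod (RL \<Sigma>) \<rho> {M}"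
      using x a M aM by (auto simp: down_mod_def reglang.intros simp flip: cls_eq_iff)
  qed (auto simp: down_mod_def)
  then have "(dSup (RL \<Sigma>) ?A, dSup (RL \<Sigma>) {M}) \<in> \<rho>"
    using R_cong A B by (simp add: R_cong_def)
  then have "cls (dSup (RL \<Sigma>) ?A) = cls (dSup (RL \<Sigma>) {M})"
    by (rule cls_eqI)
  moreover have "dSup (RL \<Sigma>) ?A = L \<union> M"
    using Union_rat_RL[OF A] by (subst dSup_RL) auto
  moreover have "dSup (RL \<Sigma>) {M} = M"
    using Union_rat_RL[OF B] by (subst dSup_RL) auto
  ultimately show ?thesis by simp
qed

lemma dleq_Q: "L \<in> reglang \<Sigma> \<Longrightarrow> M \<in> reglang \<Sigma> \<Longrightarrow> dleq Q (cls L) (cls M) \<longleftrightarrow> L \<subseteq> hull M"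
proof
  assume L: "L \<in> reglang \<Sigma>" and M: "M \<in> reglang \<Sigma>"
  show "L \<subseteq> hull M" if "dleq Q (cls L) (cls M)"
  proof
    fix w assume "w \<in> L"
    then have w: "w \<in> lists \<Sigma>" using L reglang_lists by blast
    have LM: "cls (L \<union> M) = cls M"
      using that L M by (simp add: dleq_def dplus_Q)
    have "cls ({w} \<union> M) = cls ({w} \<union> (L \<union> M))"
      using w L M LM by (intro cls_Un_cong) (auto simp: reglang_word intro: reglang.intros)
    also have "{w} \<union> (L \<union> M) = L \<union> M"
      using \<open>w \<in> L\<close> by blast
    finally show "w \<in> hull M"
      using w LM by (simp add: hull_def)
  qed
  show "dleq Q (cls L) (cls M)" if "L \<subseteq> hull M"
    using that L M by (simp add: dleq_def dplus_Q cls_Un_hull)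
qed

lemma cls_eq_hullI:
  "L \<in> reglang \<Sigma> \<Longrightarrow> M \<in> reglang \<Sigma> \<Longrightarrow> L \<subseteq> hull M \<Longrightarrow> M \<subseteq> hull L \<Longrightarrow> cls L = cls M"
  by (metis cls_Un_hull sup_commute)

lemma cls_eq_hullD: "L \<in> reglang \<Sigma> \<Longrightarrow> M \<in> reglang \<Sigma> \<Longrightarrow> cls L = cls M \<Longrightarrow> L \<subseteq> hull M"
  by (metis Un_absorb dleq_Q dleq_def dplus_Q)

text \<open>Transitivity of the quotient order, read on words. With \<open>hull_superset\<close> it
  makes \<open>hull\<close> behave as a closure operator on regular languages.\<close>

lemma hull_least:
  assumes "L \<in> reglang \<Sigma>" "M \<in> reglang \<Sigma>" "L \<subseteq> hull M" "w \<in> hull L"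
  shows "w \<in> hull M"
proof -
  have w: "w \<in> lists \<Sigma>" "cls (insert w L) = cls L"
    using assms(4) by (auto simp: hull_def)
  have LM: "cls (L \<union> M) = cls M"
    using assms by (simp add: cls_Un_hull)
  have "cls ({w} \<union> M) = cls ({w} \<union> (L \<union> M))"
    using w assms LM by (intro cls_Un_cong) (auto simp: reglang_word intro: reglang.intros)
  also have "\<dots> = cls (({w} \<union> L) \<union> M)"
    by (simp add: Un_assoc)
  also have "\<dots> = cls (L \<union> M)"
    using w assms by (intro cls_Un_cong) (auto simp: reglang_insert)
  finally show ?thesis
    using w LM by (simp add: hull_def)
qed

lemma hull_mono: "L \<in> reglang \<Sigma> \<Longrightarrow> M \<in> reglang \<Sigma> \<Longrightarrow> L \<subseteq> M \<Longrightarrow> w \<in> hull L \<Longrightarrow> w \<in> hull M"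
  using hull_least hull_superset by blast

lemma hull_lconc:
  assumes L: "L \<in> reglang \<Sigma>" and M: "M \<in> reglang \<Sigma>" and u: "u \<in> hull L" and v: "v \<in> hull M"
  shows "u @ v \<in> hull (lconc L M)"
proof -
  have uv: "u \<in> lists \<Sigma>" "v \<in> lists \<Sigma>" "cls (insert u L) = cls L" "cls (insert v M) = cls M"
    using u v by (auto simp: hull_def)
  then have "cls (lconc (insert u L) (insert v M)) = cls (lconc L M)"
    using L M by (intro cls_lconc_cong) (auto simp: reglang_insert)
  then have "lconc (insert u L) (insert v M) \<subseteq> hull (lconc L M)"
    using L M uv by (intro cls_eq_hullD rl_conc) (auto simp: reglang_insert)
  then show ?thesis by (auto intro: lconcI)
qed

lemma hull_lconcI:
  assumes "u \<in> hull L" "v \<in> hull M" "lconc L M \<subseteq> R"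
    "L \<in> reglang \<Sigma>" "M \<in> reglang \<Sigma>" "R \<in> reglang \<Sigma>"
  shows "u @ v \<in> hull R"
  using assms hull_lconc hull_mono reglang.rl_conc by metis

text \<open>No side condition is imposed on the words: the hypothesis puts \<open>u\<close> and
  \<open>v\<close> both inside or both outside \<open>lists \<Sigma>\<close>, and a foreign letter
  gives both sides the default class \<open>{}\<close>.\<close>

lemma cls_word_ctx: "cls {u} = cls {v} \<Longrightarrow> cls {a @ u @ b} = cls {a @ v @ b}"
proof -
  assume uv: "cls {u} = cls {v}"
  then have *: "u \<in> lists \<Sigma> \<longleftrightarrow> v \<in> lists \<Sigma>"
    using cls_self cls_nonregular by (metis empty_iff reglang_word)
  show ?thesis
  proof (cases "a \<in> lists \<Sigma> \<and> u \<in> lists \<Sigma> \<and> b \<in> lists \<Sigma>")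
    case True
    with * have "cls (lconc {a} (lconc {u} {b})) = cls (lconc {a} (lconc {v} {b}))"
      using uv by (intro cls_lconc_cong reglang.intros) (auto simp: reglang_word)
    then show ?thesis by simp
  next
    case False
    with * show ?thesis
      by (subst (1 2) cls_nonregular) (auto simp: reglang_word)
  qed
qed

text \<open>Here the context must lie over \<Sigma>: the right side is the class of a regular
  language, which a word with a foreign letter cannot have.\<close>

lemma cls_word_zero_ctx:
  assumes "cls {u} = cls {}" "a \<in> lists \<Sigma>" "b \<in> lists \<Sigma>"
  shows "cls {a @ u @ b} = cls {}"
proof -
  have "u \<in> lists \<Sigma>"
    using assms(1) cls_self cls_nonregular by (metis empty_iff reglang_word rl_empty)
  then have "cls (lconc {a} (lconc {u} {b})) = cls (lconc {a} (lconc {} {b}))"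
    using assms by (intro cls_lconc_cong reglang.intros) (auto simp: reglang_word intro: reglang.intros)
  then show ?thesis by simp
qed

lemma hull_cong:
  assumes "cls {u} = cls {v}" "v \<in> hull M" "M \<in> reglang \<Sigma>"
  shows "u \<in> hull M"
proof -
  have "v \<in> lists \<Sigma>" "u \<in> lists \<Sigma>"
    using assms cls_self cls_nonregular hull_lists by (metis empty_iff reglang_word)+
  then have "u \<in> hull {v}"
    using assms(1) cls_eq_hullD[of "{u}" "{v}"] by (simp add: reglang_word)
  then show ?thesis
    using hull_least[of "{v}" M u] assms \<open>v \<in> lists \<Sigma>\<close> by (simp add: reglang_word)
qed

lemma hull_zero:
  assumes "cls {u} = cls {}" "M \<in> reglang \<Sigma>"
  shows "u \<in> hull M"
proof -
  have "u \<in> lists \<Sigma>"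
    using assms cls_self cls_nonregular by (metis empty_iff reglang_word rl_empty)
  then have "u \<in> hull {}"
    using assms(1) cls_eq_hullD[of "{u}" "{}"] by (simp add: reglang_word rl_empty)
  then show ?thesis
    using hull_least[of "{}" M u] assms by (simp add: rl_empty)
qed

text \<open>Each word of \<open>lstar L\<close> already lies in a power of \<open>L\<close>, so by
  \<open>dleq_Q\<close> it belongs to the hull of any upper bound of the powers. This makes the
  class of \<open>lstar L\<close> their least upper bound in the quotient.\<close>

lemma dstar_Q:
  assumes L: "L \<in> reglang \<Sigma>"
  shows "dstar Q (cls L) = cls (lstar L)"
proof -
  have star: "lstar L \<in> reglang \<Sigma>"
    using L by (rule rl_star)
  have up: "\<exists>M\<in>reglang \<Sigma>. X = cls M \<and> M \<subseteq> lstar L" if "X \<in> mstar Q {cls L}" for X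
    using that
  proof induction
    case mstar_unit
    then show ?case
      using dunit_Q lstar_nil rl_eps by blast
  next
    case (mstar_step a x)
    then obtain M where M: "M \<in> reglang \<Sigma>" "x = cls M" "M \<subseteq> lstar L" "a = cls L" by auto
    have "dtimes Q a x = cls (lconc L M)"
      using M L by (simp add: dtimes_Q)
    moreover have "lconc L M \<subseteq> lstar L"
      using M by (auto simp: lconc_def intro: lstar_step)
    ultimately show ?case using M L rl_conc by blast
  qed
  have down: "w \<in> hull M"
    if "w \<in> lstar L" "M \<in> reglang \<Sigma>" "\<And>X. X \<in> mstar Q {cls L} \<Longrightarrow> dleq Q X (cls M)" for w M
  proof -
    have "\<exists>P\<in>reglang \<Sigma>. cls P \<in> mstar Q {cls L} \<and> w \<in> P"
      using that(1)
    proof induction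
      case lstar_nil
      then show ?case
        using mstar.mstar_unit[where D = Q and A = "{cls L}"] by (auto simp: dunit_Q intro: rl_eps)
    next
      case (lstar_step u v)
      then obtain P where P: "P \<in> reglang \<Sigma>" "cls P \<in> mstar Q {cls L}" "v \<in> P" by blast
      then have "cls (lconc L P) \<in> mstar Q {cls L}"
        using mstar.mstar_step[of "cls L" "{cls L}" "cls P" Q] L by (simp add: dtimes_Q)
      moreover have "u @ v \<in> lconc L P"
        using lstar_step P by (blast intro: lconcI)
      ultimately show ?case
        using rl_conc[OF L P(1)] by blast
    qed
    with that show ?thesis using dleq_Q by blast
  qed
  have lub: "is_lub Q (mstar Q {cls L}) (cls (lstar L))"
    unfolding is_lub_def
  proof (intro conjI ballI impI)
    show "cls (lstar L) \<in> dcar Q" using star dcar_Q by blast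
    show "dleq Q a (cls (lstar L))" if "a \<in> mstar Q {cls L}" for a
    proof -
      obtain M where "M \<in> reglang \<Sigma>" "a = cls M" "M \<subseteq> lstar L" using up[OF \<open>a \<in> _\<close>] by blast
      then show ?thesis using star hull_superset[OF star] by (auto simp: dleq_Q)
    qed
    show "dleq Q (cls (lstar L)) u"
      if u: "u \<in> dcar Q" "\<forall>a\<in>mstar Q {cls L}. dleq Q a u" for u
    proof -
      obtain M where "u = cls M" "M \<in> reglang \<Sigma>"
        using u(1) by (auto simp: dcar_Q)
      moreover have "lstar L \<subseteq> hull M"
        using down[OF _ calculation(2)] u(2) calculation(1) by auto
      ultimately show ?thesis by (simp add: dleq_Q star)
    qed
  qed
  moreover have "s = cls (lstar L)" if s: "is_lub Q (mstar Q {cls L}) s" for s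
  proof -
    obtain M where M: "s = cls M" "M \<in> reglang \<Sigma>"
      using s by (auto simp: dcar_Q is_lub_def)
    have "dleq Q s (cls (lstar L))" "dleq Q (cls (lstar L)) s"
      using s lub unfolding is_lub_def by blast+
    then have "M \<subseteq> hull (lstar L)" "lstar L \<subseteq> hull M"
      using M star by (simp_all add: dleq_Q)
    then show ?thesis
      unfolding M(1) by (rule cls_eq_hullI[OF M(2) star])
  qed
  ultimately show ?thesis
    unfolding dstar_def dSup_def by (rule the_equality)
qed

section \<open>Matrix operations on classes computed on representatives\<close>

lemma msum_Q:
  "(\<And>k. g k \<in> reglang \<Sigma>) \<Longrightarrow> msum Q n (\<lambda>k. cls (g k)) = cls (msum (RL \<Sigma>) n g)"
  by (induction n) (auto simp: dzero_Q dplus_Q msum_reglang)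

lemma mmul_Q:
  assumes "\<And>i j. M i j \<in> reglang \<Sigma>" "\<And>i j. N i j \<in> reglang \<Sigma>"
  shows "mmul Q n (\<lambda>i j. cls (M i j)) (\<lambda>i j. cls (N i j)) = (\<lambda>i j. cls (mmul (RL \<Sigma>) n M N i j))"
  using assms by (auto simp: mmul_def dtimes_Q msum_Q rl_conc)

lemma madd_Q:
  assumes "\<And>i j. M i j \<in> reglang \<Sigma>" "\<And>i j. N i j \<in> reglang \<Sigma>"
  shows "madd Q (\<lambda>i j. cls (M i j)) (\<lambda>i j. cls (N i j)) = (\<lambda>i j. cls (M i j \<union> N i j))"
  using assms by (auto simp: madd_def dplus_Q)

lemma mat_star_Q:
  assumes "\<And>i j. M i j \<in> reglang \<Sigma>"
  shows "mat_star Q n (\<lambda>i j. cls (M i j)) = (\<lambda>i j. cls (mat_star (RL \<Sigma>) n M i j))"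
  using assms
proof (induction n arbitrary: M)
  case (Suc n)
  note E = Suc.IH[of "\<lambda>i j. M (Suc i) (Suc j)", OF Suc.prems]
  note Er = mat_star_reglang[of "\<lambda>i j. M (Suc i) (Suc j)" \<Sigma> n, OF Suc.prems]
  note simps = E Er Suc.prems dtimes_Q dplus_Q msum_Q dstar_Q msum_reglang rl_conc rl_un rl_star
    dstar_RL
  show ?case
    by (intro ext) (simp add: Let_def simps)
qed (simp add: dzero_Q)

lemma bil_Q:
  assumes "\<And>i j. M i j \<in> reglang \<Sigma>" "\<And>i. S i \<in> reglang \<Sigma>" "\<And>i. F i \<in> reglang \<Sigma>"
  shows "bil Q n (\<lambda>i. cls (S i)) (\<lambda>i j. cls (M i j)) (\<lambda>i. cls (F i)) = cls (bil (RL \<Sigma>) n S M F)"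
  using assms by (simp add: bil_def dtimes_Q msum_Q rl_conc msum_reglang)

end

lemma msum_cong: "(\<And>k. k < n \<Longrightarrow> g k = h k) \<Longrightarrow> msum D n g = msum D n h"
  by (induction n) auto

lemma run_reglang:
  assumes "\<And>i j. M i j \<in> reglang \<Sigma>"
  shows "{w. run n M i w j} \<in> reglang \<Sigma>"
proof (cases "i < n \<and> j < n")
  case True
  then show ?thesis using assms mat_star_RL[of M \<Sigma> i n j] mat_star_reglang[of M \<Sigma> n i j] by simp
next
  case False
  then have "{w. run n M i w j} = {}" using run_less by blast
  then show ?thesis by (simp add: rl_empty)
qed

subsection \<open>Kleene automata\<close>

definition accepted :: "nat \<Rightarrow> nat set \<Rightarrow> (nat \<Rightarrow> nat \<Rightarrow> 'x list set) \<Rightarrow> nat set \<Rightarrow> 'x list set" where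
  "accepted n S A F = {w. \<exists>i\<in>S. \<exists>j\<in>F. run n A i w j}"

text \<open>Block upper triangular: no edge leads back from the second block, so a run crosses at
  most once, through \<open>C\<close>. For unions \<open>C\<close> is empty, for concatenations it
  holds \<open>\<epsilon>\<close>-edges.\<close>

definition blk :: "nat \<Rightarrow> (nat \<Rightarrow> nat \<Rightarrow> 'x set) \<Rightarrow> (nat \<Rightarrow> nat \<Rightarrow> 'x set) \<Rightarrow> (nat \<Rightarrow> nat \<Rightarrow> 'x set)
    \<Rightarrow> nat \<Rightarrow> nat \<Rightarrow> 'x set" where
  "blk n A C B i j =
     (if i < n then if j < n then A i j else C i (j - n)
      else if j < n then {} else B (i - n) (j - n))"

lemma blk_run_left: "run n A i w j \<Longrightarrow> run (n + m) (blk n A C B) i w j"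
proof (induction rule: run.induct)
  case (run_step i k u v j)
  then have "u \<in> blk n A C B i k" by (simp add: blk_def)
  with run_step show ?case by (intro run.run_step[OF _ _ _ run_step.IH]) auto
qed (auto intro: run_nil)

lemma blk_run_right: "run m B i w j \<Longrightarrow> run (n + m) (blk n A C B) (n + i) w (n + j)"
proof (induction rule: run.induct)
  case (run_step i k u v j)
  then have "u \<in> blk n A C B (n + i) (n + k)" by (simp add: blk_def)
  with run_step show ?case by (intro run.run_step[OF _ _ _ run_step.IH]) auto
qed (auto intro: run_nil)

lemma blk_run_cross:
  assumes "run n A i u k" "c \<in> C k l" "run m B l v j"
  shows "run (n + m) (blk n A C B) i (u @ c @ v) (n + j)"
proof (rule run_append[OF blk_run_left[OF assms(1)]])
  have "k < n" "l < m" using assms run_less by blast+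
  then show "run (n + m) (blk n A C B) k (c @ v) (n + j)"
    using assms(2) by (intro run_step[OF _ _ _ blk_run_right[OF assms(3)]]) (auto simp: blk_def)
qed

lemma blk_run_cases:
  assumes "run (n + m) (blk n A C B) i w j"
  shows "(i < n \<and> j < n \<and> run n A i w j)
    \<or> (\<exists>i' j'. i = n + i' \<and> j = n + j' \<and> run m B i' w j')
    \<or> (\<exists>k l u c v j'. j = n + j' \<and> i < n \<and> w = u @ c @ v \<and> run n A i u k \<and> c \<in> C k l \<and> run m B l v j')"
  using assms
proof (induction rule: run.induct)
  case (run_nil i)
  show ?case
  proof (cases "i < n")
    case False
    then obtain i' where "i = n + i'" using le_Suc_ex not_less by blast
    with run_nil show ?thesis by (auto intro: run.run_nil)
  qed (auto intro: run.run_nil)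
next
  case (run_step i k u v j)
  show ?case
  proof (cases "i < n")
    case i: True
    show ?thesis
    proof (cases "k < n")
      case k: True
      with i run_step have u: "u \<in> A i k" by (simp add: blk_def)
      from run_step.IH k consider "j < n" "run n A k v j"
        | k' l x c y j' where "j = n + j'" "v = x @ c @ y" "run n A k x k'" "c \<in> C k' l" "run m B l y j'"
        by fastforce
      then show ?thesis
      proof cases
        case 1
        then show ?thesis using i k u by (auto intro: run.run_step)
      next
        case 2
        moreover have "run n A i (u @ x) k'"
          using 2(3) i k u by (rule run.run_step[rotated 3])
        ultimately show ?thesis using i
          by (intro disjI2 exI[of _ k'] exI[of _ l] exI[of _ "u @ x"] exI[of _ c] exI[of _ y] exI[of _ j']) simp
      qed
    next
      case k: False
      with i run_step have u: "u \<in> C i (k - n)" by (simp add: blk_def)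
      from run_step.IH k obtain j' where "j = n + j'" "run m B (k - n) v j'" by auto
      with u i show ?thesis
        by (intro disjI2 exI[of _ i] exI[of _ "k - n"] exI[of _ "[]"] exI[of _ u] exI[of _ v] exI[of _ j'])
          (simp add: run.run_nil)
    qed
  next
    case i: False
    with run_step have k: "\<not> k < n" and u: "u \<in> B (i - n) (k - n)"
      by (auto simp: blk_def split: if_splits)
    from run_step.IH k obtain j' where j: "j = n + j'" "run m B (k - n) v j'" by auto
    have "run m B (i - n) (u @ v) j'"
      using i k run_step.hyps u by (intro run.run_step[OF _ _ _ j(2)]) auto
    moreover have "i = n + (i - n)" using i by simp
    ultimately show ?thesis using j by blast
  qed
qed

text \<open>The cut with \<open>{..<n}\<close> matters: members of \<open>S\<close> and
  \<open>F\<close> from \<open>n\<close> on have no runs in \<open>A\<close>, but in the block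
  matrix they would denote states of \<open>B\<close>.\<close>

lemma accepted_blk_Un:
  "accepted (n + m) (S \<inter> {..<n} \<union> (+) n ` T) (blk n A (\<lambda>_ _. {}) B) (F \<inter> {..<n} \<union> (+) n ` G)
    = accepted n S A F \<union> accepted m T B G"
proof (intro set_eqI iffI)
  fix w assume "w \<in> accepted (n + m) (S \<inter> {..<n} \<union> (+) n ` T) (blk n A (\<lambda>_ _. {}) B)
    (F \<inter> {..<n} \<union> (+) n ` G)"
  then obtain i j where ij: "i \<in> S \<inter> {..<n} \<union> (+) n ` T" "j \<in> F \<inter> {..<n} \<union> (+) n ` G"
    and "run (n + m) (blk n A (\<lambda>_ _. {}) B) i w j"
    by (auto simp: accepted_def)
  from blk_run_cases[OF this(3)] ij show "w \<in> accepted n S A F \<union> accepted m T B G"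
    by (fastforce simp: accepted_def)
next
  fix w assume "w \<in> accepted n S A F \<union> accepted m T B G"
  then consider i j where "i \<in> S" "j \<in> F" "run n A i w j" | i j where "i \<in> T" "j \<in> G" "run m B i w j"
    by (auto simp: accepted_def)
  then show "w \<in> accepted (n + m) (S \<inter> {..<n} \<union> (+) n ` T) (blk n A (\<lambda>_ _. {}) B)
    (F \<inter> {..<n} \<union> (+) n ` G)"
  proof cases
    case 1
    then show ?thesis
      using run_less[OF 1(3)] blk_run_left[OF 1(3), of m "\<lambda>_ _. {}" B] unfolding accepted_def by blast
  next
    case 2
    then show ?thesis
      using blk_run_right[OF 2(3), of n A "\<lambda>_ _. {}"] unfolding accepted_def by blast
  qed
qed

lemma accepted_blk_lconc:
  "accepted (n + m) (S \<inter> {..<n}) (blk n A (\<lambda>i j. if i \<in> F \<and> j \<in> T then {[]} else {}) B) ((+) n ` G)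
    = lconc (accepted n S A F) (accepted m T B G)" (is "accepted _ _ (blk n A ?C B) _ = _")
proof (intro set_eqI iffI)
  fix w assume "w \<in> accepted (n + m) (S \<inter> {..<n}) (blk n A ?C B) ((+) n ` G)"
  then obtain i j where ij: "i \<in> S" "i < n" "j \<in> G"
    and run: "run (n + m) (blk n A ?C B) i w (n + j)"
    by (auto simp: accepted_def)
  obtain k l u v where *: "w = u @ v" "run n A i u k" "k \<in> F" "l \<in> T" "run m B l v j"
    using blk_run_cases[OF run] ij(2) by (auto split: if_splits)
  then have "u \<in> accepted n S A F" "v \<in> accepted m T B G"
    using ij by (auto simp: accepted_def)
  then show "w \<in> lconc (accepted n S A F) (accepted m T B G)"
    using *(1) by (auto intro: lconcI)
next
  fix w assume "w \<in> lconc (accepted n S A F) (accepted m T B G)"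
  then obtain u v i k l j where *: "w = u @ v" "i \<in> S" "k \<in> F" "run n A i u k"
    "l \<in> T" "j \<in> G" "run m B l v j"
    by (auto simp: accepted_def elim!: lconcE)
  then have "run (n + m) (blk n A ?C B) i (u @ [] @ v) (n + j)"
    by (intro blk_run_cross) auto
  then show "w \<in> accepted (n + m) (S \<inter> {..<n}) (blk n A ?C B) ((+) n ` G)"
    using * run_less[OF *(4)] by (auto simp: accepted_def)
qed

lemma run_mono: "run n A i w j \<Longrightarrow> (\<And>i j. A i j \<subseteq> B i j) \<Longrightarrow> run n B i w j"
  by (induction rule: run.induct) (auto intro: run.intros)

text \<open>\<open>\<epsilon>\<close>-edges from final back to initial states allow repetition. The
  empty word is added by hand, since no state need be both initial and final.\<close>

lemma accepted_feedback:
  assumes L: "L = accepted n S A F"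
  shows "insert [] (accepted n S (\<lambda>i j. A i j \<union> (if i \<in> F \<and> j \<in> S then {[]} else {})) F) = lstar L"
    (is "insert [] (accepted n S ?A F) = _")
proof (intro set_eqI iffI)
  \<comment> \<open>A run into \<open>F\<close> is cut at its first feedback edge, or at its end if
    there is none: before the cut it is a run of \<open>A\<close> into \<open>F\<close>, and the
    rest lies in \<open>lstar L\<close>. The start state stays arbitrary for the induction.\<close>
  have *: "\<exists>u v k. w = u @ v \<and> k \<in> F \<and> run n A i u k \<and> v \<in> lstar L" if "run n ?A i w j" "j \<in> F" for i w j
    using that
  proof (induction rule: run.induct)
    case (run_nil i)
    then show ?case by (auto intro: run.run_nil lstar_nil)
  next
    case (run_step i k u v j)
    then obtain x y l where v: "v = x @ y" "l \<in> F" "run n A k x l" "y \<in> lstar L" by blast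
    from run_step(3) consider "u \<in> A i k" | "u = []" "i \<in> F" "k \<in> S"
      by (auto split: if_splits)
    then show ?case
    proof cases
      case 1
      then have "run n A i (u @ x) l"
        using run_step.hyps v(3) by (intro run.run_step)
      then show ?thesis using v by (metis append_assoc)
    next
      case 2
      then have "x \<in> L" using v by (auto simp: L accepted_def)
      then have "v \<in> lstar L" using v by (auto intro: lstar_step)
      then show ?thesis using 2 run_step.hyps
        by (metis append_Nil run.run_nil)
    qed
  qed
  fix w assume "w \<in> insert [] (accepted n S ?A F)"
  then show "w \<in> lstar L"
  proof
    assume "w \<in> accepted n S ?A F"
    then obtain i j where "i \<in> S" "j \<in> F" "run n ?A i w j" by (auto simp: accepted_def)
    with *[of i w j] obtain u v k where "w = u @ v" "k \<in> F" "run n A i u k" "v \<in> lstar L" by blast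
    moreover from this \<open>i \<in> S\<close> have "u \<in> L" by (auto simp: L accepted_def)
    ultimately show ?thesis by (auto intro: lstar_step)
  qed (simp add: lstar_nil)
next
  fix w assume "w \<in> lstar L"
  then show "w \<in> insert [] (accepted n S ?A F)"
  proof induction
    case (lstar_step u v)
    then obtain i j where u: "i \<in> S" "j \<in> F" "run n A i u j" by (auto simp: L accepted_def)
    have u': "run n ?A i u j" using u(3) by (rule run_mono) auto
    show ?case
    proof (cases "v = []")
      case True
      then show ?thesis using u u' by (auto simp: accepted_def)
    next
      case False
      with lstar_step.IH obtain k l where v: "k \<in> S" "l \<in> F" "run n ?A k v l"
        by (auto simp: accepted_def)
      have "[] \<in> ?A j k" using u v by auto
      with u' v(3) have "run n ?A j ([] @ v) l"
        using run_less[OF u'] run_less[OF v(3)] by (intro run.run_step) auto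
      with u' have "run n ?A i (u @ v) l" by (auto intro: run_append)
      then show ?thesis using u v by (auto simp: accepted_def)
    qed
  qed simp
qed

text \<open>Labels are kept apart in three matrices; the middle class must absorb \<open>\<epsilon>\<close>-transitions.\<close>
locale label_classes =
  fixes \<U> \<X> \<V> :: "'x list set set"
  assumes empty: "{} \<in> \<U>" "{} \<in> \<X>" "{} \<in> \<V>"
    and insert_eps: "\<And>L. L \<in> \<X> \<Longrightarrow> insert [] L \<in> \<X>"
begin

definition recognizable :: "'x list set \<Rightarrow> bool" where
  "recognizable L \<longleftrightarrow> (\<exists>n S F U X V. n \<ge> 1 \<and> (\<forall>i j. U i j \<in> \<U> \<and> X i j \<in> \<X> \<and> V i j \<in> \<V>) \<and>
     L = accepted n S (\<lambda>i j. U i j \<union> X i j \<union> V i j) F)"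

lemma recognizableI:
  assumes "n \<ge> 1" "\<And>i j. U i j \<in> \<U>" "\<And>i j. X i j \<in> \<X>" "\<And>i j. V i j \<in> \<V>"
    "L = accepted n S (\<lambda>i j. U i j \<union> X i j \<union> V i j) F"
  shows "recognizable L"
  using assms unfolding recognizable_def by blast

lemma recognizableE:
  assumes "recognizable L"
  obtains n S F U X V where "n \<ge> 1" "\<And>i j. U i j \<in> \<U>" "\<And>i j. X i j \<in> \<X>" "\<And>i j. V i j \<in> \<V>"
    "L = accepted n S (\<lambda>i j. U i j \<union> X i j \<union> V i j) F"
  using assms unfolding recognizable_def by blast

lemma recognizable_label:
  assumes L: "L \<in> \<U> \<union> \<X> \<union> \<V>"
  shows "recognizable L"
proof -
  \<comment> \<open>A single edge from state 0 to state 1. \<open>L\<close> is put into every matrix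
    whose class contains it, which avoids a case split and leaves the union of the three
    unchanged.\<close>
  define at where "at \<L> i j = (if i = (0::nat) \<and> j = (1::nat) \<and> L \<in> \<L> then L else {})" for \<L> i j
  let ?A = "\<lambda>i j. at \<U> i j \<union> at \<X> i j \<union> at \<V> i j"
  have A: "?A i j = (if i = 0 \<and> j = 1 then L else {})" for i j
    using L by (auto simp: at_def)
  have "i = j \<and> w = [] \<or> i = 0 \<and> j = 1 \<and> w \<in> L" if "run 2 ?A i w j" for i w j
    using that by induction (auto simp: A split: if_splits)
  moreover have "run 2 ?A 0 w 1" if "w \<in> L" for w
    using that by (intro run_single) (auto simp: A)
  ultimately have "L = accepted 2 {0} ?A {1}"
    by (fastforce simp: accepted_def)
  then show ?thesis
    by (intro recognizableI[of 2 "at \<U>" "at \<X>" "at \<V>"]) (auto simp: at_def empty)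
qed

lemma eps_label: "{[]} \<in> \<X>"
  using insert_eps[OF empty(2)] by simp

lemma recognizable_Un:
  assumes "recognizable L" "recognizable M"
  shows "recognizable (L \<union> M)"
proof -
  from assms(1) obtain n S F U X V where 1: "n \<ge> 1" "\<And>i j. U i j \<in> \<U>" "\<And>i j. X i j \<in> \<X>"
    "\<And>i j. V i j \<in> \<V>" and L: "L = accepted n S (\<lambda>i j. U i j \<union> X i j \<union> V i j) F" (is "_ = accepted _ _ ?A _")
    by (elim recognizableE) (rule that)
  from assms(2) obtain m T G U' X' V' where 2: "m \<ge> 1" "\<And>i j. U' i j \<in> \<U>" "\<And>i j. X' i j \<in> \<X>"
    "\<And>i j. V' i j \<in> \<V>" and M: "M = accepted m T (\<lambda>i j. U' i j \<union> X' i j \<union> V' i j) G" (is "_ = accepted _ _ ?B _")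
    by (elim recognizableE) (rule that)
  let ?E = "\<lambda>_ _. {}"
  have "blk n ?A ?E ?B = (\<lambda>i j. blk n U ?E U' i j \<union> blk n X ?E X' i j \<union> blk n V ?E V' i j)"
    by (auto simp: blk_def fun_eq_iff)
  then show ?thesis
    using 1 2 empty L M accepted_blk_Un[of n m S T ?A ?B F G]
    by (intro recognizableI[of "n + m" "blk n U ?E U'" "blk n X ?E X'" "blk n V ?E V'"]) (auto simp: blk_def)
qed

lemma recognizable_lconc:
  assumes "recognizable L" "recognizable M"
  shows "recognizable (lconc L M)"
proof -
  from assms(1) obtain n S F U X V where 1: "n \<ge> 1" "\<And>i j. U i j \<in> \<U>" "\<And>i j. X i j \<in> \<X>"
    "\<And>i j. V i j \<in> \<V>" and L: "L = accepted n S (\<lambda>i j. U i j \<union> X i j \<union> V i j) F" (is "_ = accepted _ _ ?A _")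
    by (elim recognizableE) (rule that)
  from assms(2) obtain m T G U' X' V' where 2: "m \<ge> 1" "\<And>i j. U' i j \<in> \<U>" "\<And>i j. X' i j \<in> \<X>"
    "\<And>i j. V' i j \<in> \<V>" and M: "M = accepted m T (\<lambda>i j. U' i j \<union> X' i j \<union> V' i j) G" (is "_ = accepted _ _ ?B _")
    by (elim recognizableE) (rule that)
  let ?E = "\<lambda>_ _. {}" and ?C = "\<lambda>i j. if i \<in> F \<and> j \<in> T then {[]} else {}"
  have "blk n ?A ?C ?B = (\<lambda>i j. blk n U ?E U' i j \<union> blk n X ?C X' i j \<union> blk n V ?E V' i j)"
    by (auto simp: blk_def fun_eq_iff)
  then show ?thesis
    using 1 2 empty eps_label L M accepted_blk_lconc[of n m S ?A F T ?B G]
    by (intro recognizableI[of "n + m" "blk n U ?E U'" "blk n X ?C X'" "blk n V ?E V'"]) (auto simp: blk_def)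
qed

lemma recognizable_lstar:
  assumes "recognizable L"
  shows "recognizable (lstar L)"
proof -
  from assms obtain n S F U X V where 1: "n \<ge> 1" "\<And>i j. U i j \<in> \<U>" "\<And>i j. X i j \<in> \<X>"
    "\<And>i j. V i j \<in> \<V>" and L: "L = accepted n S (\<lambda>i j. U i j \<union> X i j \<union> V i j) F"
    by (elim recognizableE) (rule that)
  let ?X = "\<lambda>i j. X i j \<union> (if i \<in> F \<and> j \<in> S then {[]} else {})"
  have A: "(\<lambda>i j. U i j \<union> X i j \<union> V i j \<union> (if i \<in> F \<and> j \<in> S then {[]} else {})) =
    (\<lambda>i j. U i j \<union> ?X i j \<union> V i j)"
    by auto
  have "recognizable (accepted n S (\<lambda>i j. U i j \<union> ?X i j \<union> V i j) F)"
    using 1 insert_eps by (intro recognizableI[of n U ?X V]) auto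
  then have "recognizable ({[]} \<union> accepted n S (\<lambda>i j. U i j \<union> ?X i j \<union> V i j) F)"
    using recognizable_label eps_label by (intro recognizable_Un) auto
  then show ?thesis
    using accepted_feedback[OF L] unfolding A by simp
qed

lemma recognizable_reglang:
  assumes "L \<in> reglang \<Sigma>" "\<And>x. x \<in> \<Sigma> \<Longrightarrow> {[x]} \<in> \<U> \<union> \<X> \<union> \<V>"
  shows "recognizable L"
  using assms
  by (induction rule: reglang.induct)
    (auto intro: recognizable_label recognizable_Un recognizable_lconc recognizable_lstar
      simp: empty eps_label)

end

subsection \<open>Scalars and brackets\<close>

text \<open>In the application \<open>\<C>\<close> has a letter for each element of
  \<open>C2'\<close>, not only for the four brackets, because membership in \<open>ZC\<close> is
  tested against all of them.\<close>

locale bracket_quotient = regular_quotient \<Sigma> \<rho> for \<Sigma> :: "'x set" and \<rho> +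
  fixes \<K> \<C> :: "'x set" and p q :: "bool \<Rightarrow> 'x"
  assumes alphabet: "\<Sigma> = \<K> \<union> \<C>"
    and brackets: "p i \<in> \<C>" "q i \<in> \<C>"
    and cancel: "cls {[p i, q j]} = cls (if i = j then {[]} else {})"
    and scalar_letter_commute: "a \<in> \<K> \<Longrightarrow> c \<in> \<C> \<Longrightarrow> cls {[a, c]} = cls {[c, a]}"
begin

lemma bracket_letters [simp]: "p i \<in> \<Sigma>" "q i \<in> \<Sigma>"
  using brackets by (auto simp: alphabet)

lemma scalar_lists: "k \<in> lists \<K> \<Longrightarrow> k \<in> lists \<Sigma>"
  by (auto simp: alphabet)

lemma cancel_ctx: "cls {x @ p i # q i # y} = cls {x @ y}"
  using cls_word_ctx[of "[p i, q i]" "[]" x y] cancel[of i i] by simp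

lemma clash_ctx: "i \<noteq> j \<Longrightarrow> x \<in> lists \<Sigma> \<Longrightarrow> y \<in> lists \<Sigma> \<Longrightarrow> cls {x @ p i # q j # y} = cls {}"
  using cls_word_zero_ctx[of "[p i, q j]" x y] cancel[of i j] by simp

lemma scalar_commute_letter: "k \<in> lists \<K> \<Longrightarrow> c \<in> \<C> \<Longrightarrow> cls {x @ k @ c # y} = cls {x @ c # k @ y}"
proof (induction k arbitrary: x)
  case (Cons a k)
  have "cls {x @ (a # k) @ c # y} = cls {(x @ [a]) @ c # k @ y}"
    using Cons.IH[of "x @ [a]"] Cons.prems by simp
  also have "\<dots> = cls {x @ c # (a # k) @ y}"
    using cls_word_ctx[of "[a, c]" "[c, a]" x "k @ y"] scalar_letter_commute[of a c] Cons.prems by simp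
  finally show ?case .
qed simp

lemma scalar_commute:
  "k \<in> lists \<K> \<Longrightarrow> c \<in> lists \<C> \<Longrightarrow> cls {x @ k @ c @ y} = cls {x @ c @ k @ y}"
proof (induction c arbitrary: x)
  case (Cons a c)
  have "cls {x @ k @ (a # c) @ y} = cls {(x @ [a]) @ k @ c @ y}"
    using scalar_commute_letter[of k a x "c @ y"] Cons.prems by simp
  also have "\<dots> = cls {x @ (a # c) @ k @ y}"
    using Cons.IH[of "x @ [a]"] Cons.prems by simp
  finally show ?case .
qed simp

lemma sandwich_scalar: "k \<in> lists \<K> \<Longrightarrow> cls {p i # k @ [q i]} = cls {k}"
  using scalar_commute_letter[of k "q i" "[p i]" "[]"] cancel_ctx[of "[]" i k] brackets by simp

end

text \<open>The matrix \<open>N = p\<^sub>0 (U p\<^sub>1 + X + q\<^sub>1 V)\<^sup>* q\<^sub>0\<close>, with \<open>p\<^sub>0 = p False\<close> and \<open>p\<^sub>1 = p True\<close>.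
  The inserted \<open>p\<^sub>1\<close> and \<open>q\<^sub>1\<close> leave the cancellation of \<open>U\<close> against \<open>V\<close> unchanged, but make
  every unmatched bracket clash with the end markers \<open>p\<^sub>0\<close> and \<open>q\<^sub>0\<close>.\<close>
locale bracket_system = bracket_quotient \<Sigma> \<rho> \<K> \<C> p q
  for \<Sigma> :: "'x set" and \<rho> \<K> \<C> p q +
  fixes n :: nat and U X V :: "nat \<Rightarrow> nat \<Rightarrow> 'x list set"
  assumes U: "U i j \<in> {{}, {[p False]}, {[p True]}}"
    and V: "V i j \<in> {{}, {[q False]}, {[q True]}}"
    and X_regular: "X i j \<in> reglang \<Sigma>" and X_scalar: "X i j \<subseteq> lists \<K>"
begin

definition A where "A i j = U i j \<union> X i j \<union> V i j"

definition B where "B i j = lconc (U i j) {[p True]} \<union> X i j \<union> lconc {[q True]} (V i j)"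

definition N where "N i j = {p False # w @ [q False] | w. run n B i w j}"

definition NV where "NV = mmul (RL \<Sigma>) n N V"

definition U_N where "U_N = mmul (RL \<Sigma>) n U N"

definition T where
  "T = mmul (RL \<Sigma>) n (mat_star (RL \<Sigma>) n NV) (mmul (RL \<Sigma>) n N (mat_star (RL \<Sigma>) n U_N))"

lemma U_cases: "u \<in> U i j \<Longrightarrow> \<exists>a. u = [p a]"
  using U[of i j] by fastforce

lemma V_cases: "v \<in> V i j \<Longrightarrow> \<exists>a. v = [q a]"
  using V[of i j] by fastforce

lemma U_regular: "U i j \<in> reglang \<Sigma>" and V_regular: "V i j \<in> reglang \<Sigma>"
  using U[of i j] V[of i j] by (elim insertE emptyE; simp add: reglang_word rl_empty)+

lemma A_regular: "A i j \<in> reglang \<Sigma>" and B_regular: "B i j \<in> reglang \<Sigma>"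
  unfolding A_def B_def
  by (intro rl_un rl_conc U_regular V_regular X_regular; simp add: reglang_word)+

lemma N_regular: "N i j \<in> reglang \<Sigma>"
proof -
  have "N i j = lconc {[p False]} (lconc {w. run n B i w j} {[q False]})"
    by (auto simp: N_def lconc_def)
  moreover have "lconc {[p False]} (lconc {w. run n B i w j} {[q False]}) \<in> reglang \<Sigma>"
    by (intro rl_conc run_reglang B_regular) (simp_all add: reglang_word)
  ultimately show ?thesis by simp
qed

lemma NV_regular: "NV i j \<in> reglang \<Sigma>" and U_N_regular: "U_N i j \<in> reglang \<Sigma>"
  unfolding NV_def U_N_def by (intro mmul_reglang N_regular V_regular U_regular)+

lemma NV_I: "k < n \<Longrightarrow> u \<in> N i k \<Longrightarrow> v \<in> V k j \<Longrightarrow> u @ v \<in> NV i j"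
  unfolding NV_def mmul_RL by blast

lemma NV_E:
  assumes "w \<in> NV i j" obtains k u v where "k < n" "w = u @ v" "u \<in> N i k" "v \<in> V k j"
  using assms unfolding NV_def mmul_RL by blast

lemma U_N_I: "k < n \<Longrightarrow> u \<in> U i k \<Longrightarrow> v \<in> N k j \<Longrightarrow> u @ v \<in> U_N i j"
  unfolding U_N_def mmul_RL by blast

lemma U_N_E:
  assumes "w \<in> U_N i j" obtains k u v where "k < n" "w = u @ v" "u \<in> U i k" "v \<in> N k j"
  using assms unfolding U_N_def mmul_RL by blast

lemma T_regular: "T i j \<in> reglang \<Sigma>"
  unfolding T_def by (intro mmul_reglang mat_star_reglang NV_regular U_N_regular N_regular)

lemma T_iff:
  assumes "i < n" "j < n"
  shows "w \<in> T i j \<longleftrightarrow> (\<exists>k<n. \<exists>l<n. \<exists>a b c. w = a @ b @ c \<and> run n NV i a k \<and> b \<in> N k l \<and> run n U_N l c j)"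
proof -
  have "mat_star (RL \<Sigma>) n NV i k = {w. run n NV i w k}" "mat_star (RL \<Sigma>) n U_N k j = {w. run n U_N k w j}"
    if "k < n" for k
    using assms that by (simp_all add: mat_star_RL NV_regular U_N_regular)
  then have T: "w \<in> T i j \<longleftrightarrow> (\<exists>k<n. \<exists>a. run n NV i a k \<and>
      (\<exists>v. (\<exists>l<n. \<exists>b\<in>N k l. \<exists>c. run n U_N l c j \<and> v = b @ c) \<and> w = a @ v))"
    by (simp add: T_def mmul_RL Bex_def cong: conj_cong)
  show ?thesis unfolding T by blast
qed

lemma T_mem: "run n NV i a k \<Longrightarrow> b \<in> N k l \<Longrightarrow> run n U_N l c j \<Longrightarrow> a @ b @ c \<in> T i j"
  using run_less[of n NV i a k] run_less[of n U_N l c j] T_iff[of i j "a @ b @ c"] by blast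

section \<open>Reduction of the words spelled by runs of \<open>B\<close>\<close>

definition q_word where "q_word xs = concat (map (\<lambda>i. [q True, q i]) xs)"

definition p_word where "p_word ys = concat (map (\<lambda>i. [p i, p True]) ys)"

lemma q_word_lists: "q_word xs \<in> lists \<C>"
  by (induction xs) (simp_all add: q_word_def brackets)

lemma p_word_lists: "p_word ys \<in> lists \<C>"
  by (induction ys) (simp_all add: p_word_def brackets)

lemma C_lists: "c \<in> lists \<C> \<Longrightarrow> c \<in> lists \<Sigma>"
  by (auto simp: alphabet)

text \<open>A word that does not vanish reduces to unmatched closing brackets, a scalar and
  unmatched opening brackets, each bracket with its marker. The companion \<open>v\<close> uses the
  same edges without markers, so it undergoes the same cancellations and ends with the same
  \<open>xs\<close>, \<open>k\<close>, \<open>ys\<close>. Since edges are prepended, a new opening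
  bracket only ever meets the leftmost closing one.\<close>

lemma run_normal_form:
  assumes "run n B i w j"
  shows "cls {w} = cls {} \<or> (\<exists>xs k ys v. k \<in> lists \<K> \<and> run n A i v j \<and>
    cls {w} = cls {q_word xs @ k @ p_word ys} \<and> cls {v} = cls {map q xs @ k @ map p ys})"
  using assms
proof (induction rule: run.induct)
  case (run_nil i)
  then show ?case
    by (intro disjI2 exI[of _ "[]"]) (auto simp: q_word_def p_word_def intro: run.run_nil)
next
  case (run_step i l u w j)
  have u: "u \<in> lists \<Sigma>"
    using run_step.hyps B_regular reglang_lists by blast
  from run_step.IH show ?case
  proof (elim disjE exE conjE)
    assume "cls {w} = cls {}"
    then show ?thesis using cls_word_zero_ctx[of w u "[]"] u by simp
  next
    fix xs k ys v
    assume k: "k \<in> lists \<K>" and v: "run n A l v j"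
      and w: "cls {w} = cls {q_word xs @ k @ p_word ys}"
      and v': "cls {v} = cls {map q xs @ k @ map p ys}"
    have uw: "cls {u @ w} = cls {u @ q_word xs @ k @ p_word ys}"
      using cls_word_ctx[OF w, of u "[]"] by simp
    have step: "run n A i (x @ v) j" "cls {x @ v} = cls {x @ map q xs @ k @ map p ys}"
      if "x \<in> A i l" for x
      using that v run_step.hyps cls_word_ctx[OF v', of x "[]"] by (auto intro: run.run_step)
    have qs: "map q xs \<in> lists \<C>" using brackets by auto
    from run_step.hyps(3) consider (X) "u \<in> X i l"
      | (U) a where "[p a] \<in> U i l" "u = [p a, p True]"
      | (V) a where "[q a] \<in> V i l" "u = [q True, q a]"
    proof -
      from run_step.hyps(3) consider "u \<in> lconc (U i l) {[p True]}" | "u \<in> X i l"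
        | "u \<in> lconc {[q True]} (V i l)"
        unfolding B_def by blast
      then show ?thesis
      proof cases
        case 1
        then obtain x where "u = x @ [p True]" "x \<in> U i l" by (elim lconcE) simp
        then show ?thesis using U_cases[of x i l] that(2) by auto
      next
        case 3
        then obtain x where "u = [q True] @ x" "x \<in> V i l" by (elim lconcE) simp
        then show ?thesis using V_cases[of x i l] that(3) by auto
      qed (rule that(1))
    qed
    then show ?thesis
    proof cases
      case X
      then have uK: "u \<in> lists \<K>" and uA: "u \<in> A i l"
        using X_scalar by (auto simp: A_def)
      have "cls {u @ w} = cls {q_word xs @ (u @ k) @ p_word ys}"
        using uw scalar_commute[OF uK q_word_lists, of "[]" xs "k @ p_word ys"] by simp
      moreover have "cls {u @ v} = cls {map q xs @ (u @ k) @ map p ys}"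
        using step(2)[OF uA] scalar_commute[OF uK qs, of "[]" "k @ map p ys"] by simp
      ultimately show ?thesis
        using step(1)[OF uA] uK k
        by (intro disjI2 exI[of _ xs] exI[of _ "u @ k"] exI[of _ ys] exI[of _ "u @ v"]) simp
    next
      case V
      then have "[q a] \<in> A i l" by (auto simp: A_def)
      from step[OF this] show ?thesis
        using V uw k
        by (intro disjI2 exI[of _ "a # xs"] exI[of _ k] exI[of _ ys] exI[of _ "[q a] @ v"])
          (simp add: q_word_def)
    next
      case U
      then have uA: "[p a] \<in> A i l" by (auto simp: A_def)
      show ?thesis
      proof (cases xs)
        case Nil
        have "cls {u @ w} = cls {q_word [] @ k @ p_word (a # ys)}"
          using uw scalar_commute[OF k, of "[p a, p True]" "[]" "p_word ys"] U Nil brackets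
          by (simp add: q_word_def p_word_def)
        moreover have "cls {[p a] @ v} = cls {map q [] @ k @ map p (a # ys)}"
          using step(2)[OF uA] scalar_commute_letter[OF k, of "p a" "[]" "map p ys"] Nil brackets
          by simp
        ultimately show ?thesis
          using step(1)[OF uA] k
          by (intro disjI2 exI[of _ "[]"] exI[of _ k] exI[of _ "a # ys"] exI[of _ "[p a] @ v"]) simp
      next
        case (Cons b xs')
        let ?R = "q_word xs' @ k @ p_word ys"
        have R: "?R \<in> lists \<Sigma>"
          using C_lists[OF q_word_lists] C_lists[OF p_word_lists] scalar_lists[OF k] by simp
        \<comment> \<open>The word starts with \<open>p a\<close>, \<open>p True\<close>,
          \<open>q True\<close>, \<open>q b\<close>. The inner markers cancel, and then
          \<open>p a\<close> and \<open>q b\<close> meet, to cancel or to clash.\<close>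
        have uw': "cls {u @ w} = cls {p a # q b # ?R}"
          using uw cancel_ctx[of "[p a]" True "q b # ?R"] U Cons by (simp add: q_word_def)
        show ?thesis
        proof (cases "a = b")
          case True
          have "cls {u @ w} = cls {?R}"
            using uw' cancel_ctx[of "[]" a ?R] True by simp
          moreover have "cls {[p a] @ v} = cls {map q xs' @ k @ map p ys}"
            using step(2)[OF uA] cancel_ctx[of "[]" a "map q xs' @ k @ map p ys"] True Cons by simp
          ultimately show ?thesis
            using step(1)[OF uA] k
            by (intro disjI2 exI[of _ xs'] exI[of _ k] exI[of _ ys] exI[of _ "[p a] @ v"]) simp
        next
          case False
          then show ?thesis
            using uw' clash_ctx[of a b "[]" ?R] R by simp
        qed
      qed
    qed
  qed
qed

text \<open>The front marker \<open>p False\<close> clashes with the \<open>q True\<close> opening a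
  nonempty \<open>q_word\<close>, and the \<open>p True\<close> closing a nonempty
  \<open>p_word\<close> clashes with the end marker \<open>q False\<close>. Only scalars survive,
  with a run of \<open>A\<close> of the same value.\<close>

lemma marked_run:
  assumes "run n B i w j"
  shows "cls {p False # w @ [q False]} = cls {} \<or>
    (\<exists>k v. k \<in> lists \<K> \<and> run n A i v j \<and> cls {w} = cls {k} \<and> cls {v} = cls {k})"
  using run_normal_form[OF assms]
proof (elim disjE exE conjE)
  assume "cls {w} = cls {}"
  then show ?thesis using cls_word_zero_ctx[of w "[p False]" "[q False]"] by simp
next
  fix xs k ys v
  assume k: "k \<in> lists \<K>" and v: "run n A i v j"
    and w: "cls {w} = cls {q_word xs @ k @ p_word ys}"
    and v': "cls {v} = cls {map q xs @ k @ map p ys}"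
  have eq: "cls {p False # w @ [q False]} = cls {p False # q_word xs @ k @ p_word ys @ [q False]}"
    using cls_word_ctx[OF w, of "[p False]" "[q False]"] by simp
  have kL: "k \<in> lists \<Sigma>" using k by (rule scalar_lists)
  note lists = C_lists[OF q_word_lists] C_lists[OF p_word_lists] kL
  \<comment> \<open>\<open>ys\<close> is split at its right end because the end marker meets the
    last letter of \<open>p_word ys\<close>.\<close>
  consider (q) b xs' where "xs = b # xs'" | (p) b ys' where "ys = ys' @ [b]" | (none) "xs = []" "ys = []"
    by (cases xs; cases ys rule: rev_cases) auto
  then show ?thesis
  proof cases
    case q
    then show ?thesis
      using eq clash_ctx[of False True "[]" "q b # q_word xs' @ k @ p_word ys @ [q False]"] lists
      by (simp add: q_word_def)
  next
    case p
    then show ?thesis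
      using eq clash_ctx[of True False "p False # q_word xs @ k @ p_word ys' @ [p b]" "[]"] lists
      by (simp add: p_word_def)
  next
    case none
    then show ?thesis using k v w v' by (auto simp: q_word_def p_word_def)
  qed
qed

lemma marked_scalar: "cls {w} = cls {k} \<Longrightarrow> k \<in> lists \<K> \<Longrightarrow> cls {p False # w @ [q False]} = cls {k}"
  using cls_word_ctx[of w k "[p False]" "[q False]"] sandwich_scalar[of k False] by simp

text \<open>Commutation already holds for each word of \<open>N\<close> separately: its class is
  zero or that of a word over \<open>\<K>\<close>, and such a word commutes with every letter of
  \<open>\<C>\<close>.\<close>

lemma N_commute:
  assumes c: "c \<in> \<C>"
  shows "cls (lconc (N i j) {[c]}) = cls (lconc {[c]} (N i j))"
proof (rule cls_eq_hullI)
  have cL: "[c] \<in> lists \<Sigma>" using c by (simp add: alphabet)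
  show reg: "lconc (N i j) {[c]} \<in> reglang \<Sigma>" "lconc {[c]} (N i j) \<in> reglang \<Sigma>"
    using cL by (intro rl_conc N_regular; simp add: reglang_word)+
  have eq: "cls {z @ [c]} = cls {[c] @ z}" if z: "z \<in> N i j" for z
  proof -
    obtain w where w: "z = p False # w @ [q False]" "run n B i w j"
      using z by (auto simp: N_def)
    from marked_run[OF w(2)] show ?thesis
    proof (elim disjE exE conjE)
      assume "cls {p False # w @ [q False]} = cls {}"
      then show ?thesis
        using cls_word_zero_ctx[of z "[]" "[c]"] cls_word_zero_ctx[of z "[c]" "[]"] cL w(1) by simp
    next
      fix k assume k: "k \<in> lists \<K>" "cls {w} = cls {k}"
      then have "cls {z} = cls {k}" using marked_scalar w(1) by simp
      then show ?thesis
        using cls_word_ctx[of z k "[]" "[c]"] cls_word_ctx[of z k "[c]" "[]"]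
          scalar_commute_letter[OF k(1) c, of "[]" "[]"] by simp
    qed
  qed
  show "lconc (N i j) {[c]} \<subseteq> hull (lconc {[c]} (N i j))"
  proof
    fix y assume "y \<in> lconc (N i j) {[c]}"
    then obtain z where z: "y = z @ [c]" "z \<in> N i j" by (auto elim: lconcE)
    then have "[c] @ z \<in> hull (lconc {[c]} (N i j))"
      by (intro hull_superset reg lconcI) auto
    then show "y \<in> hull (lconc {[c]} (N i j))"
      using hull_cong[OF eq[OF z(2)] _ reg(2)] z(1) by simp
  qed
  show "lconc {[c]} (N i j) \<subseteq> hull (lconc (N i j) {[c]})"
  proof
    fix y assume "y \<in> lconc {[c]} (N i j)"
    then obtain z where z: "y = [c] @ z" "z \<in> N i j" by (auto elim: lconcE)
    then have "z @ [c] \<in> hull (lconc (N i j) {[c]})"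
      by (intro hull_superset reg lconcI) auto
    then show "y \<in> hull (lconc (N i j) {[c]})"
      using hull_cong[OF eq[OF z(2), symmetric] _ reg(1)] z(1) by simp
  qed
qed

text \<open>Factors known only up to saturation may be replaced by actual words of \<open>L\<close>
  and \<open>M\<close> when their product is to be placed in a hull.\<close>

lemma hull_lconc_least:
  assumes "u \<in> hull L" "v \<in> hull M" "\<And>u v. u \<in> L \<Longrightarrow> v \<in> M \<Longrightarrow> u @ v \<in> hull R"
    "L \<in> reglang \<Sigma>" "M \<in> reglang \<Sigma>" "R \<in> reglang \<Sigma>"
  shows "u @ v \<in> hull R"
  using assms(3-6) hull_lconc[OF assms(4,5,1,2)]
  by (intro hull_least[of "lconc L M" R]) (auto intro: rl_conc elim!: lconcE)

section \<open>Closure properties of \<open>N\<close>\<close>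

lemma N_I: "run n B i w j \<Longrightarrow> p False # w @ [q False] \<in> hull (N i j)"
  by (intro hull_superset N_regular) (auto simp: N_def)

lemma eps_N: "i < n \<Longrightarrow> [] \<in> hull (N i i)"
  using hull_cong[of "[]" "[p False, q False]" "N i i"] N_I[of i "[]" i] N_regular cancel[of False False]
  by (simp add: run_nil)

lemma X_N: "i < n \<Longrightarrow> j < n \<Longrightarrow> u \<in> X i j \<Longrightarrow> u \<in> hull (N i j)"
  using hull_cong[of u "p False # u @ [q False]" "N i j"] N_I[of i u j] N_regular X_scalar[of i j]
    sandwich_scalar[of u False] run_single[of i n j u B]
  by (auto simp: B_def)

text \<open>The inner \<open>q False\<close>, \<open>p False\<close> cannot be cancelled. Instead
  the first factor is replaced by its scalar \<open>a\<close>, \<open>a\<close> moves behind the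
  \<open>p False\<close> of the second factor, and there it is turned back into \<open>x\<close>;
  the runs \<open>x\<close> and \<open>y\<close> then compose.\<close>

lemma N_N:
  assumes "u \<in> hull (N i k)" "v \<in> hull (N k j)"
  shows "u @ v \<in> hull (N i j)"
proof (rule hull_lconc_least[OF assms _ N_regular N_regular N_regular])
  fix u v assume u: "u \<in> N i k" and v: "v \<in> N k j"
  obtain x y where x: "u = p False # x @ [q False]" "run n B i x k"
    and y: "v = p False # y @ [q False]" "run n B k y j"
    using u v by (auto simp: N_def)
  have vL: "v \<in> lists \<Sigma>" using v N_regular reglang_lists by blast
  from marked_run[OF x(2)] show "u @ v \<in> hull (N i j)"
  proof (elim disjE exE conjE)
    assume "cls {p False # x @ [q False]} = cls {}"
    then show ?thesis
      using cls_word_zero_ctx[of u "[]" v] vL x(1) by (intro hull_zero N_regular) simp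
  next
    fix a assume a: "a \<in> lists \<K>" "cls {x} = cls {a}"
    have "cls {u @ v} = cls {a @ v}"
      using marked_scalar[OF a(2,1)] x(1) cls_word_ctx[of u a "[]" v] by simp
    also have "\<dots> = cls {p False # a @ y @ [q False]}"
      using scalar_commute_letter[of a "p False" "[]" "y @ [q False]"] a brackets y(1) by simp
    also have "\<dots> = cls {p False # (x @ y) @ [q False]}"
      using cls_word_ctx[OF a(2), of "[p False]" "y @ [q False]"] by simp
    finally show ?thesis
      using N_I[OF run_append[OF x(2) y(2)]] by (rule hull_cong) (rule N_regular)
  qed
qed

text \<open>Extending the run inside \<open>w\<close> by the two bracket edges of \<open>B\<close>
  gives a word of \<open>N\<close>. For equal indices it and \<open>u @ w @ v\<close> both reduce to
  the scalar of \<open>w\<close>; for different ones \<open>u @ w @ v\<close> vanishes.\<close>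

lemma U_N_V:
  assumes "u \<in> U i k" "w \<in> N k l" "v \<in> V l j" "i < n" "j < n"
  shows "u @ w @ v \<in> hull (N i j)"
proof -
  obtain a b where ab: "u = [p a]" "v = [q b]" using assms U_cases V_cases by blast
  obtain x where x: "w = p False # x @ [q False]" "run n B k x l"
    using assms(2) by (auto simp: N_def)
  note kl = run_less[OF x(2)]
  have "[p a, p True] \<in> B i k" "[q True, q b] \<in> B l j"
    using assms ab lconcI[of "[p a]" "U i k" "[p True]"] lconcI[of "[q True]" "{[q True]}" "[q b]" "V l j"]
    by (auto simp: B_def)
  then have "run n B i ([p a, p True] @ x @ [q True, q b]) j"
    using kl assms by (intro run_append[OF run_single run_append[OF x(2) run_single]]) auto
  from N_I[OF this] have mem: "[p False, p a, p True] @ x @ [q True, q b, q False] \<in> hull (N i j)"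
    by simp
  from marked_run[OF x(2)] show ?thesis
  proof (elim disjE exE conjE)
    assume "cls {p False # x @ [q False]} = cls {}"
    then show ?thesis
      using cls_word_zero_ctx[of w u v] x(1) ab by (intro hull_zero N_regular) simp
  next
    fix k' assume k': "k' \<in> lists \<K>" "cls {x} = cls {k'}"
    have kL: "k' \<in> lists \<Sigma>" using k'(1) by (rule scalar_lists)
    have "cls {u @ w @ v} = cls {[p a] @ k' @ [q b]}"
      using cls_word_ctx[OF marked_scalar[OF k'(2,1)], of u v] x(1) ab by simp
    also have "\<dots> = cls {k' @ [p a, q b]}"
      using scalar_commute_letter[of k' "p a" "[]" "[q b]"] k' brackets by simp
    finally have 1: "cls {u @ w @ v} = cls {k' @ [p a, q b]}" .
    show ?thesis
    proof (cases "a = b")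
      case True
      have "cls {[p False, p a, p True] @ x @ [q True, q b, q False]}
          = cls {[p False, p a, p True] @ k' @ [q True, q b, q False]}"
        by (rule cls_word_ctx[OF k'(2)])
      also have "\<dots> = cls {k' @ [p False, p a, p True, q True, q b, q False]}"
        using scalar_commute[OF k'(1), of "[p False, p a, p True]" "[]" "[q True, q b, q False]"] brackets
        by simp
      also have "\<dots> = cls {k' @ [p False, p a, q b, q False]}"
        using cancel_ctx[of "k' @ [p False, p a]" True "[q b, q False]"] by simp
      also have "\<dots> = cls {k' @ [p False, q False]}"
        using cancel_ctx[of "k' @ [p False]" a "[q False]"] True by simp
      also have "\<dots> = cls {k' @ [p a, q b]}"
        using cancel_ctx[of k' False "[]"] cancel_ctx[of k' a "[]"] True by simp
      finally show ?thesis
        using 1 mem by (intro hull_cong[OF _ mem N_regular]) simp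
    next
      case False
      then show ?thesis
        using 1 clash_ctx[of a b k' "[]"] kL by (intro hull_zero N_regular) simp
    qed
  qed
qed

text \<open>Up to saturation the labels of such a run lie in \<open>N\<close>, and \<open>N\<close>
  contains the empty word on its diagonal and is closed under products.\<close>

lemma N_star:
  assumes "run n (\<lambda>i j. mmul (RL \<Sigma>) n U NV i j \<union> N i j) i w j"
  shows "w \<in> hull (N i j)"
  using assms
proof (induction rule: run.induct)
  case (run_step i k u v j)
  from run_step(3) have "u \<in> hull (N i k)"
  proof
    assume "u \<in> mmul (RL \<Sigma>) n U NV i k"
    then show ?thesis
      using run_step.hyps by (auto simp: mmul_RL NV_def intro: U_N_V)
  qed (rule hull_superset[OF N_regular])
  then show ?case using run_step.IH by (rule N_N)
qed (rule eps_N)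

section \<open>The bound \<open>T \<le> A\<^sup>*\<close>\<close>

lemma A_star_trans:
  assumes "u \<in> hull {w. run n A i w k}" "v \<in> hull {w. run n A k w j}"
  shows "u @ v \<in> hull {w. run n A i w j}"
  by (rule hull_lconc_least[OF assms])
    (auto intro!: hull_superset run_reglang A_regular intro: run_append)

lemma A_A_star: "i < n \<Longrightarrow> j < n \<Longrightarrow> u \<in> A i j \<Longrightarrow> u \<in> hull {w. run n A i w j}"
  by (auto intro!: hull_superset run_reglang A_regular run_single)

text \<open>The companion run of \<open>marked_run\<close> enters here: a nonvanishing word of
  \<open>N\<close> has the same class as the word of that run of \<open>A\<close>.\<close>

lemma N_A_star:
  assumes "z \<in> N i j"
  shows "z \<in> hull {w. run n A i w j}"
proof -
  obtain w where w: "z = p False # w @ [q False]" "run n B i w j"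
    using assms by (auto simp: N_def)
  have reg: "{w. run n A i w j} \<in> reglang \<Sigma>" by (intro run_reglang A_regular)
  from marked_run[OF w(2)] show ?thesis
  proof (elim disjE exE conjE)
    assume "cls {p False # w @ [q False]} = cls {}"
    then show ?thesis using w(1) reg by (intro hull_zero) auto
  next
    fix k v assume kv: "k \<in> lists \<K>" "run n A i v j" "cls {w} = cls {k}" "cls {v} = cls {k}"
    then have "cls {z} = cls {v}" using marked_scalar[of w k] w(1) by simp
    then show ?thesis using kv(2) reg by (intro hull_cong[OF _ hull_superset]) auto
  qed
qed

lemma run_A_star:
  assumes "run n M i w j" and "\<And>i j w. i < n \<Longrightarrow> j < n \<Longrightarrow> w \<in> M i j \<Longrightarrow> w \<in> hull {w. run n A i w j}"
  shows "w \<in> hull {w. run n A i w j}"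
  using assms(1)
proof (induction rule: run.induct)
  case (run_nil i)
  then show ?case by (intro hull_superset run_reglang A_regular) (auto intro: run.run_nil)
next
  case (run_step i k u v j)
  then show ?case using assms(2) A_star_trans by blast
qed

lemma T_A_star:
  assumes "i < n" "j < n" "w \<in> T i j"
  shows "w \<in> hull {w. run n A i w j}"
proof -
  have NV: "w \<in> hull {w. run n A i w j}" if w: "w \<in> NV i j" and ij: "i < n" "j < n" for i j w
  proof -
    obtain k u v where "k < n" "w = u @ v" "u \<in> N i k" "v \<in> V k j" using w by (rule NV_E)
    then show ?thesis
      using A_star_trans[OF N_A_star A_A_star] ij by (simp add: A_def)
  qed
  have U_N: "w \<in> hull {w. run n A i w j}" if w: "w \<in> U_N i j" and ij: "i < n" "j < n" for i j w
  proof -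
    obtain k u v where "k < n" "w = u @ v" "u \<in> U i k" "v \<in> N k j" using w by (rule U_N_E)
    then show ?thesis
      using A_star_trans[OF A_A_star N_A_star] ij by (simp add: A_def)
  qed
  obtain k l a b c where "w = a @ b @ c" "run n NV i a k" "b \<in> N k l" "run n U_N l c j"
    using assms by (auto simp: T_iff)
  then show ?thesis
    using A_star_trans[OF run_A_star[OF _ NV] A_star_trans[OF N_A_star run_A_star[OF _ U_N]]]
    by simp
qed

section \<open>The bound \<open>A\<^sup>* \<le> T\<close>\<close>

lemma T_I:
  assumes "a \<in> hull {w. run n NV i w k}" "b \<in> hull (N k l)" "c \<in> hull {w. run n U_N l w j}"
    and "i < n" "j < n" "k < n" "l < n"
  shows "a @ b @ c \<in> hull (T i j)"
proof -
  let ?M = "{w. run n U_N l w j}"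
  have regs: "{w. run n NV i w k} \<in> reglang \<Sigma>" "?M \<in> reglang \<Sigma>"
    by (intro run_reglang NV_regular U_N_regular)+
  have bc: "b @ c \<in> hull (lconc (N k l) ?M)"
    using assms regs by (intro hull_lconc N_regular)
  show ?thesis
  proof (rule hull_lconc_least[OF assms(1) bc])
    show "u @ v \<in> hull (T i j)" if "u \<in> {w. run n NV i w k}" "v \<in> lconc (N k l) ?M" for u v
      using that by (intro hull_superset T_regular) (auto elim!: lconcE intro: T_mem)
  qed (use regs N_regular T_regular in \<open>auto intro: rl_conc\<close>)
qed

lemma run_hull: "run n M i w j \<Longrightarrow> (\<And>i j. M i j \<in> reglang \<Sigma>) \<Longrightarrow> w \<in> hull {w. run n M i w j}"
  by (intro hull_superset run_reglang) auto

lemma run_hull_step: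
  assumes "u \<in> hull (M i k)" "run n M k v j" "i < n" and M: "\<And>i j. M i j \<in> reglang \<Sigma>"
  shows "u @ v \<in> hull {w. run n M i w j}"
proof (rule hull_lconc_least[OF assms(1) run_hull[OF assms(2) M] _ M])
  show "u @ v \<in> hull {w. run n M i w j}" if "u \<in> M i k" "v \<in> {w. run n M k w j}" for u v
    using that run_less[OF assms(2)] assms(3) by (intro run_hull M) (auto intro: run_step)
qed (intro run_reglang M)+

text \<open>The first factor of a word of \<open>(NV)\<^sup>*\<close> starts in \<open>N\<close>, so an \<open>N\<close> on the left is absorbed.\<close>
lemma N_T:
  assumes "x \<in> hull (N i m)" "t \<in> T m j" "i < n" "m < n" "j < n"
  shows "x @ t \<in> hull (T i j)"
proof -
  obtain k l a b c where t: "t = a @ b @ c" "run n NV m a k" "b \<in> N k l" "run n U_N l c j"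
    using assms by (auto simp: T_iff)
  note kl = run_less[OF t(2)] run_less[OF t(4)]
  note c = run_hull[OF t(4) U_N_regular] and b = hull_superset[OF N_regular t(3)]
  from t(2) show ?thesis
  proof cases
    \<comment> \<open>Without a factor \<open>NV\<close> the word \<open>x\<close> is absorbed by
      the middle factor \<open>N\<close>.\<close>
    case run_nil
    have "[] @ (x @ b) @ c \<in> hull (T i j)"
      using assms kl N_N[OF assms(1), of b l] b c run_nil
        T_I[OF run_hull[OF run.run_nil[OF assms(3)] NV_regular], of "x @ b" l c j]
      by simp
    then show ?thesis using t(1) run_nil by simp
  next
    case (run_step k' u a')
    then obtain l' y v where u: "u = y @ v" "y \<in> N m l'" "v \<in> V l' k'" "l' < n"
      by (elim NV_E)
    have "x @ y \<in> hull (N i l')"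
      using N_N[OF assms(1)] u hull_superset[OF N_regular] by blast
    then have "(x @ y) @ v \<in> hull (NV i k')"
    proof (rule hull_lconcI[OF _ hull_superset[OF V_regular u(3)]])
      show "lconc (N i l') (V l' k') \<subseteq> NV i k'"
        using u(4) by (auto elim!: lconcE intro: NV_I)
    qed (intro N_regular V_regular NV_regular)+
    from run_hull_step[OF this run_step(5) assms(3) NV_regular]
    have "((x @ y) @ v) @ a' \<in> hull {w. run n NV i w k}" .
    from T_I[OF this b c] show ?thesis
      using t(1) u(1) run_step kl assms by simp
  qed
qed

text \<open>A scalar edge is a word of \<open>N\<close> and falls under \<open>N_T\<close>. A
  closing bracket, preceded by the empty word of \<open>N\<close>, starts a new factor
  \<open>NV\<close>. An opening bracket joins the first factor \<open>NV\<close> of \<open>t\<close>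
  into a word of \<open>U N V\<close>, hence of \<open>N\<close>; if there is none, it starts a new
  factor \<open>UN\<close>.\<close>

lemma A_T:
  assumes "u \<in> A i m" "t \<in> T m j" "i < n" "m < n" "j < n"
  shows "u @ t \<in> hull (T i j)"
proof -
  obtain k l a b c where t: "t = a @ b @ c" "run n NV m a k" "b \<in> N k l" "run n U_N l c j"
    using assms by (auto simp: T_iff)
  note kl = run_less[OF t(2)] run_less[OF t(4)]
  note c = run_hull[OF t(4) U_N_regular] and b = hull_superset[OF N_regular t(3)]
  from assms(1) consider "u \<in> X i m" | "u \<in> V i m" | "u \<in> U i m" by (auto simp: A_def)
  then show ?thesis
  proof cases
    case 1
    then show ?thesis using assms X_N N_T by blast
  next
    case 2
    have "[] @ u \<in> hull (NV i m)"
    proof (rule hull_lconcI[OF eps_N[OF assms(3)] hull_superset[OF V_regular 2]])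
      show "lconc (N i i) (V i m) \<subseteq> NV i m"
        using assms(3) by (auto elim!: lconcE intro: NV_I)
    qed (intro N_regular V_regular NV_regular)+
    then have "u @ a \<in> hull {w. run n NV i w k}"
      using run_hull_step[of u NV i m a k] t(2) assms(3) NV_regular by simp
    from T_I[OF this b c] show ?thesis
      using t(1) kl assms by simp
  next
    case 3
    from t(2) show ?thesis
    proof cases
      \<comment> \<open>The middle word \<open>b\<close> moves into the new factor
        \<open>UN\<close>, and the empty word takes its place in \<open>N\<close>.\<close>
      case run_nil
      have "u @ b \<in> hull (U_N i l)"
        using 3 t(3) run_nil assms(4) by (intro hull_superset U_N_regular) (auto intro: U_N_I)
      then have "(u @ b) @ c \<in> hull {w. run n U_N i w j}"
        using t(4) assms(3) U_N_regular by (intro run_hull_step)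
      then have "[] @ [] @ (u @ b) @ c \<in> hull (T i j)"
        using assms T_I[OF run_hull[OF run.run_nil[OF assms(3)] NV_regular] eps_N[OF assms(3)]]
        by blast
      then show ?thesis using t(1) run_nil by simp
    next
      case (run_step k' x a')
      then obtain l' y v where x: "x = y @ v" "y \<in> N m l'" "v \<in> V l' k'" "l' < n"
        by (elim NV_E)
      have "u @ y @ v \<in> hull (N i k')"
        using 3 x run_step assms by (intro U_N_V) auto
      moreover have "a' @ b @ c \<in> T k' j"
        using run_step t(3,4) by (intro T_mem)
      ultimately have "(u @ y @ v) @ (a' @ b @ c) \<in> hull (T i j)"
        using run_step assms by (intro N_T) auto
      then show ?thesis using t(1) x(1) run_step by simp
    qed
  qed
qed

lemma A_star_T:
  assumes "run n A i w j"
  shows "w \<in> hull (T i j)"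
  using assms
proof (induction rule: run.induct)
  case (run_nil i)
  then have "[] @ [] @ [] \<in> hull (T i i)"
    by (intro T_I[of _ i i _ i] eps_N run_hull NV_regular U_N_regular) (auto intro: run.run_nil)
  then show ?case by simp
next
  case (run_step i k u v j)
  note ij = run_step.hyps run_less[OF run_step(4)]
  have "u \<in> hull (A i k)" using run_step by (intro hull_superset A_regular)
  from this run_step.IH show ?case
    by (rule hull_lconc_least) (use ij in \<open>auto intro: A_T A_regular T_regular\<close>)
qed

lemma mem_bil_RL:
  "w \<in> bil (RL \<Sigma>) n (\<lambda>i. if i \<in> S then {[]} else {}) M (\<lambda>j. if j \<in> F then {[]} else {})
    \<longleftrightarrow> (\<exists>i<n. \<exists>j<n. i \<in> S \<and> j \<in> F \<and> w \<in> M i j)"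
  by (auto simp: bil_def msum_RL lconc_def split: if_splits)

lemma accepted_normal_form:
  "cls (accepted n S A F) =
    cls (bil (RL \<Sigma>) n (\<lambda>i. if i \<in> S then {[]} else {}) T (\<lambda>j. if j \<in> F then {[]} else {}))"
    (is "cls ?L = cls ?M")
proof -
  have L: "?L = bil (RL \<Sigma>) n (\<lambda>i. if i \<in> S then {[]} else {}) (\<lambda>i j. {w. run n A i w j})
      (\<lambda>j. if j \<in> F then {[]} else {})"
    using run_less by (fastforce simp: accepted_def mem_bil_RL)
  have bil_reg: "bil (RL \<Sigma>) n (\<lambda>i. if i \<in> S then {[]} else {}) M (\<lambda>j. if j \<in> F then {[]} else {}) \<in> reglang \<Sigma>"
    if "\<And>i j. M i j \<in> reglang \<Sigma>" for M
    using that unfolding bil_def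
    by (auto intro!: msum_reglang rl_conc rl_empty rl_eps)
  have sub: "w \<in> hull (bil (RL \<Sigma>) n (\<lambda>i. if i \<in> S then {[]} else {}) M' (\<lambda>j. if j \<in> F then {[]} else {}))"
    if w: "w \<in> bil (RL \<Sigma>) n (\<lambda>i. if i \<in> S then {[]} else {}) M (\<lambda>j. if j \<in> F then {[]} else {})"
      and M': "\<And>i j. M' i j \<in> reglang \<Sigma>" and "\<And>i j w. i < n \<Longrightarrow> j < n \<Longrightarrow> w \<in> M i j \<Longrightarrow> w \<in> hull (M' i j)"
    for M M' w
  proof -
    obtain i j where ij: "i < n" "j < n" "i \<in> S" "j \<in> F" "w \<in> M i j"
      using w unfolding mem_bil_RL by blast
    show ?thesis
    proof (rule hull_mono[OF M'[of i j] bil_reg[OF M']])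
      show "M' i j \<subseteq> bil (RL \<Sigma>) n (\<lambda>i. if i \<in> S then {[]} else {}) M' (\<lambda>j. if j \<in> F then {[]} else {})"
        using ij unfolding mem_bil_RL subset_iff by blast
      show "w \<in> hull (M' i j)"
        using ij that(3) by blast
    qed
  qed
  show ?thesis
    unfolding L
    by (intro cls_eq_hullI bil_reg subsetI; (erule sub)?)
      (auto intro: run_reglang A_regular T_regular A_star_T T_A_star)
qed

end

subsection \<open>The tensor product\<close>

text \<open>This ensures that the star relations in \<open>hom_rel K Inl\<close> only mention
  letters of the alphabet, so that \<open>least_R_cong\<close> applies to them.\<close>

lemma R_dioid_dstar:
  assumes D: "R_dioid D" and a: "a \<in> dcar D"
  shows "dstar D a \<in> dcar D"
proof -
  have comm: "\<And>x y. x \<in> dcar D \<Longrightarrow> y \<in> dcar D \<Longrightarrow> dplus D x y = dplus D y x"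
    using D by (simp add: R_dioid_def dioid_def)
  have "mstar D {a} \<in> rat D"
    using a by (intro rat_star rat_fin) auto
  then obtain s where s: "is_lub D (mstar D {a}) s"
    using D unfolding R_dioid_def by blast
  have "dSup D (mstar D {a}) = s"
    unfolding dSup_def
  proof (rule the_equality)
    show "is_lub D (mstar D {a}) s" by (rule s)
    fix t assume t: "is_lub D (mstar D {a}) t"
    have "dleq D s t" "dleq D t s" "s \<in> dcar D" "t \<in> dcar D"
      using s t unfolding is_lub_def by blast+
    then show "t = s" using comm[of s t] by (simp add: dleq_def)
  qed
  then show ?thesis using s by (simp add: dstar_def is_lub_def)
qed

lemma hom_rel_regular:
  assumes "\<And>a b. a \<in> dcar D \<Longrightarrow> b \<in> dcar D \<Longrightarrow> dplus D a b \<in> dcar D"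
    and "\<And>a b. a \<in> dcar D \<Longrightarrow> b \<in> dcar D \<Longrightarrow> dtimes D a b \<in> dcar D"
    and "\<And>a. a \<in> dcar D \<Longrightarrow> dstar D a \<in> dcar D"
    and "dzero D \<in> dcar D" "dunit D \<in> dcar D"
    and emb: "\<And>a. a \<in> dcar D \<Longrightarrow> emb a \<in> \<Sigma>"
  shows "hom_rel D emb \<subseteq> reglang \<Sigma> \<times> reglang \<Sigma>"
  using assms by (auto simp: hom_rel_def reglang_word rl_empty intro!: reglang_insert rl_star)

lemma C2_rel_regular: "C2_rel \<subseteq> reglang UNIV \<times> reglang UNIV"
  by (auto simp: C2_rel_def reglang_word rl_empty)

interpretation C2: regular_quotient UNIV C2_rho
  unfolding C2_rho_def using least_R_cong(1)[OF C2_rel_regular] by unfold_locales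

lemma C2'_eq: "C2' = C2.Q"
  by (simp add: C2'_def)

lemma gen_eq: "gen x = C2.cls {[x]}"
  by (simp add: gen_def C2.cls_def)

lemma C2_cancel: "(L, M) \<in> C2_rel \<Longrightarrow> C2.cls L = C2.cls M"
  using least_R_cong(2)[OF C2_rel_regular] by (intro C2.cls_eqI) (auto simp: C2_rho_def)

lemma C2'_closed:
  "a \<in> dcar C2' \<Longrightarrow> b \<in> dcar C2' \<Longrightarrow> dplus C2' a b \<in> dcar C2'"
  "a \<in> dcar C2' \<Longrightarrow> b \<in> dcar C2' \<Longrightarrow> dtimes C2' a b \<in> dcar C2'"
  "a \<in> dcar C2' \<Longrightarrow> dstar C2' a \<in> dcar C2'"
  "dzero C2' \<in> dcar C2'" "dunit C2' \<in> dcar C2'" "gen x \<in> dcar C2'"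
proof -
  show "dplus C2' a b \<in> dcar C2'" "dtimes C2' a b \<in> dcar C2'"
    if "a \<in> dcar C2'" "b \<in> dcar C2'" for a b
    using that by (auto simp: C2'_eq C2.dcar_Q C2.dplus_Q C2.dtimes_Q rl_un rl_conc)
  show "dstar C2' a \<in> dcar C2'" if "a \<in> dcar C2'" for a
    using that by (auto simp: C2'_eq C2.dcar_Q C2.dstar_Q rl_star)
  show "dzero C2' \<in> dcar C2'" "dunit C2' \<in> dcar C2'" "gen x \<in> dcar C2'"
    by (simp_all add: C2'_eq C2.dcar_Q C2.dzero_Q C2.dunit_Q gen_eq rl_empty rl_eps rl_letter)
qed

section \<open>Spelling the elements of \<open>C2'\<close> by the four brackets\<close>

lemma map_image_lconc: "map f ` lconc L M = lconc (map f ` L) (map f ` M)"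
proof (intro set_eqI iffI)
  fix w assume "w \<in> lconc (map f ` L) (map f ` M)"
  then obtain u v where uv: "w = map f (u @ v)" "u \<in> L" "v \<in> M"
    by (auto elim!: lconcE)
  from uv(1) lconcI[OF uv(2,3)] show "w \<in> map f ` lconc L M" by (rule image_eqI)
qed (auto elim!: lconcE intro!: lconcI)

lemma map_image_lstar: "map f ` lstar L = lstar (map f ` L)"
proof (intro set_eqI iffI)
  fix w assume "w \<in> map f ` lstar L"
  then obtain v where "v \<in> lstar L" "w = map f v" by blast
  then show "w \<in> lstar (map f ` L)"
    by (induction arbitrary: w rule: lstar.induct) (auto intro: lstar.intros)
next
  fix w assume "w \<in> lstar (map f ` L)"
  then show "w \<in> map f ` lstar L"
  proof induction
    case lstar_nil
    then show ?case by (force intro: lstar.intros)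
  next
    case (lstar_step u v)
    then obtain x y where "x \<in> L" "y \<in> lstar L" "u = map f x" "v = map f y" by blast
    then have "u @ v = map f (x @ y)" "x @ y \<in> lstar L"
      by (auto intro: lstar.lstar_step)
    then show ?case by (rule image_eqI)
  qed
qed

lemma map_image_reglang: "L \<in> reglang \<Sigma> \<Longrightarrow> (\<And>x. x \<in> \<Sigma> \<Longrightarrow> f x \<in> \<Sigma>') \<Longrightarrow> map f ` L \<in> reglang \<Sigma>'"
  by (induction rule: reglang.induct)
    (auto simp: image_Un map_image_lconc map_image_lstar intro: reglang.intros)

locale C2_tensor =
  fixes K :: "'k dioid"
  assumes R_dioid: "R_dioid K"
begin

abbreviation \<Sigma> where "\<Sigma> \<equiv> dcar K <+> dcar C2'"

lemma K_closed:
  "a \<in> dcar K \<Longrightarrow> b \<in> dcar K \<Longrightarrow> dplus K a b \<in> dcar K"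
  "a \<in> dcar K \<Longrightarrow> b \<in> dcar K \<Longrightarrow> dtimes K a b \<in> dcar K"
  "dzero K \<in> dcar K" "dunit K \<in> dcar K"
  using R_dioid by (auto simp: R_dioid_def dioid_def)

abbreviation relations where
  "relations \<equiv> hom_rel K Inl \<union> hom_rel C2' Inr \<union> comm_rel K C2'"

lemma relations_regular: "relations \<subseteq> reglang \<Sigma> \<times> reglang \<Sigma>"
proof -
  have "hom_rel K Inl \<subseteq> reglang \<Sigma> \<times> reglang \<Sigma>"
    by (intro hom_rel_regular K_closed R_dioid_dstar[OF R_dioid]) auto
  moreover have "hom_rel C2' Inr \<subseteq> reglang \<Sigma> \<times> reglang \<Sigma>"
    by (intro hom_rel_regular C2'_closed) auto
  moreover have "comm_rel K C2' \<subseteq> reglang \<Sigma> \<times> reglang \<Sigma>"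
    by (auto simp: comm_rel_def reglang_word)
  ultimately show ?thesis by blast
qed

sublocale regular_quotient \<Sigma> "tensor_rho K C2'"
  unfolding tensor_rho_def using least_R_cong(1)[OF relations_regular] by unfold_locales

lemma tensor_eq: "tensor K C2' = Q"
  by (simp add: tensor_def)

lemma inR_eq: "inR K C2' c = cls {[Inr c]}"
  by (simp add: inR_def cls_def)

lemma cls_relations: "(L, M) \<in> relations \<Longrightarrow> cls L = cls M"
  using least_R_cong(2)[OF relations_regular] by (intro cls_eqI) (auto simp: tensor_rho_def)

lemma cls_Inr:
  "a \<in> dcar C2' \<Longrightarrow> b \<in> dcar C2' \<Longrightarrow> cls {[Inr (dplus C2' a b)]} = cls ({[Inr a]} \<union> {[Inr b]})"
  "a \<in> dcar C2' \<Longrightarrow> b \<in> dcar C2' \<Longrightarrow> cls {[Inr (dtimes C2' a b)]} = cls (lconc {[Inr a]} {[Inr b]})"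
  "a \<in> dcar C2' \<Longrightarrow> cls {[Inr (dstar C2' a)]} = cls (lstar {[Inr a]})"
  "cls {[Inr (dzero C2')]} = cls {}" "cls {[Inr (dunit C2')]} = cls {[]}"
proof -
  show "cls {[Inr (dplus C2' a b)]} = cls ({[Inr a]} \<union> {[Inr b]})" if "a \<in> dcar C2'" "b \<in> dcar C2'"
    using that by (intro cls_relations) (simp add: hom_rel_def; blast)
  show "cls {[Inr (dtimes C2' a b)]} = cls (lconc {[Inr a]} {[Inr b]})" if "a \<in> dcar C2'" "b \<in> dcar C2'"
    using that by (intro cls_relations) (simp add: hom_rel_def; blast)
  show "cls {[Inr (dstar C2' a)]} = cls (lstar {[Inr a]})" if "a \<in> dcar C2'"
    using that by (intro cls_relations) (simp add: hom_rel_def; blast)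
  show "cls {[Inr (dzero C2')]} = cls {}" "cls {[Inr (dunit C2')]} = cls {[]}"
    by (intro cls_relations; simp add: hom_rel_def)+
qed

definition letters :: "delta list set \<Rightarrow> ('k + delta list set set) list set" where
  "letters L = map (\<lambda>x. Inr (gen x)) ` L"

lemma letters_regular: "L \<in> reglang UNIV \<Longrightarrow> letters L \<in> reglang \<Sigma>"
  unfolding letters_def by (rule map_image_reglang) (auto simp: C2'_closed)

lemma cls_lstar_cong:
  "L \<in> reglang \<Sigma> \<Longrightarrow> M \<in> reglang \<Sigma> \<Longrightarrow> cls L = cls M \<Longrightarrow> cls (lstar L) = cls (lstar M)"
  by (metis dstar_Q)

text \<open>The relations in \<open>hom_rel\<close> match the clauses of \<open>reglang\<close>:
  zero, unit, sum, product and star. Induction therefore expands the single letter for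
  \<open>C2.cls L\<close> into \<open>L\<close> spelled with generators.\<close>

lemma cls_letters:
  assumes "L \<in> reglang UNIV"
  shows "cls {[Inr (C2.cls L)]} = cls (letters L)"
  using assms
proof (induction rule: reglang.induct)
  case rl_empty
  then show ?case using cls_Inr(4) by (simp add: letters_def C2'_eq C2.dzero_Q)
next
  case rl_eps
  then show ?case using cls_Inr(5) by (simp add: letters_def C2'_eq C2.dunit_Q)
next
  case (rl_letter x)
  then show ?case by (simp add: letters_def gen_eq)
next
  case (rl_un L M)
  have mem: "C2.cls L \<in> dcar C2'" "C2.cls M \<in> dcar C2'"
    using rl_un by (auto simp: C2'_eq C2.dcar_Q)
  have "cls {[Inr (C2.cls (L \<union> M))]} = cls ({[Inr (C2.cls L)]} \<union> {[Inr (C2.cls M)]})"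
    using cls_Inr(1)[OF mem] rl_un.hyps by (simp add: C2'_eq C2.dplus_Q)
  also have "\<dots> = cls (letters L \<union> letters M)"
    using rl_un mem by (intro cls_Un_cong letters_regular) (auto simp: reglang_word)
  finally show ?case by (simp add: letters_def image_Un)
next
  case (rl_conc L M)
  have mem: "C2.cls L \<in> dcar C2'" "C2.cls M \<in> dcar C2'"
    using rl_conc by (auto simp: C2'_eq C2.dcar_Q)
  have "cls {[Inr (C2.cls (lconc L M))]} = cls (lconc {[Inr (C2.cls L)]} {[Inr (C2.cls M)]})"
    using cls_Inr(2)[OF mem] rl_conc.hyps by (simp add: C2'_eq C2.dtimes_Q)
  also have "\<dots> = cls (lconc (letters L) (letters M))"
    using rl_conc mem by (intro cls_lconc_cong letters_regular) (auto simp: reglang_word)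
  finally show ?case by (simp add: letters_def map_image_lconc)
next
  case (rl_star L)
  have mem: "C2.cls L \<in> dcar C2'"
    using rl_star by (auto simp: C2'_eq C2.dcar_Q)
  have "cls {[Inr (C2.cls (lstar L))]} = cls (lstar {[Inr (C2.cls L)]})"
    using cls_Inr(3)[OF mem] rl_star.hyps by (simp add: C2'_eq C2.dstar_Q)
  also have "\<dots> = cls (lstar (letters L))"
    using rl_star mem by (intro cls_lstar_cong letters_regular) (auto simp: reglang_word)
  finally show ?case by (simp add: letters_def map_image_lstar)
qed

definition \<Gamma> :: "('k + delta list set set) set" where
  "\<Gamma> = Inl ` dcar K \<union> range (\<lambda>x. Inr (gen x))"

lemma \<Gamma>_regular: "L \<in> reglang \<Gamma> \<Longrightarrow> L \<in> reglang \<Sigma>"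
  by (erule reglang_mono) (auto simp: \<Gamma>_def C2'_closed)

text \<open>The automaton may only carry scalars and the four brackets, so letters for other
  elements of \<open>C2'\<close> are eliminated first.\<close>

lemma reduce_alphabet:
  assumes "L \<in> reglang \<Sigma>"
  shows "\<exists>M\<in>reglang \<Gamma>. cls L = cls M"
  using assms
proof (induction rule: reglang.induct)
  case (rl_letter x)
  then consider a where "x = Inl a" "a \<in> dcar K" | c where "x = Inr c" "c \<in> dcar C2'" by auto
  then show ?case
  proof cases
    case 1
    then have "{[x]} \<in> reglang \<Gamma>" by (intro reglang.intros) (auto simp: \<Gamma>_def)
    then show ?thesis by blast
  next
    case 2
    then obtain L where L: "L \<in> reglang UNIV" "c = C2.cls L" by (auto simp: C2'_eq C2.dcar_Q)
    have "letters L \<in> reglang \<Gamma>"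
      unfolding letters_def by (rule map_image_reglang[OF L(1)]) (auto simp: \<Gamma>_def)
    then show ?thesis using cls_letters[OF L(1)] 2 L(2) by auto
  qed
next
  case (rl_un L M)
  then obtain L' M' where *: "L' \<in> reglang \<Gamma>" "cls L = cls L'" "M' \<in> reglang \<Gamma>" "cls M = cls M'"
    by blast
  have "cls (L \<union> M) = cls (L' \<union> M')"
    using * rl_un.hyps by (intro cls_Un_cong) (auto intro: \<Gamma>_regular)
  then show ?case using * reglang.rl_un by blast
next
  case (rl_conc L M)
  then obtain L' M' where *: "L' \<in> reglang \<Gamma>" "cls L = cls L'" "M' \<in> reglang \<Gamma>" "cls M = cls M'"
    by blast
  have "cls (lconc L M) = cls (lconc L' M')"
    using * rl_conc.hyps by (intro cls_lconc_cong) (auto intro: \<Gamma>_regular)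
  then show ?case using * reglang.rl_conc by blast
next
  case (rl_star L)
  then obtain L' where *: "L' \<in> reglang \<Gamma>" "cls L = cls L'" by blast
  have "cls (lstar L) = cls (lstar L')"
    using * rl_star.hyps by (intro cls_lstar_cong) (auto intro: \<Gamma>_regular)
  then show ?case using * reglang.rl_star by blast
qed (auto intro: reglang.intros)

definition p :: "bool \<Rightarrow> 'k + delta list set set" where "p i = Inr (gen (if i then p1 else p0))"

definition q :: "bool \<Rightarrow> 'k + delta list set set" where "q i = Inr (gen (if i then q1 else q0))"

lemma cancel_letters:
  assumes "({[x, y]}, L) \<in> C2_rel"
  shows "cls {[Inr (gen x), Inr (gen y)]} = cls (letters L)"
proof -
  have "{[x, y]} \<in> reglang UNIV" "L \<in> reglang UNIV"
    using assms C2_rel_regular by blast+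
  then have "cls (letters {[x, y]}) = cls (letters L)"
    using cls_letters C2_cancel[OF assms] by metis
  then show ?thesis by (simp add: letters_def)
qed

sublocale bracket_quotient \<Sigma> "tensor_rho K C2'" "Inl ` dcar K" "Inr ` dcar C2'" p q
proof
  show "\<Sigma> = Inl ` dcar K \<union> Inr ` dcar C2'" by auto
  show "p i \<in> Inr ` dcar C2'" "q i \<in> Inr ` dcar C2'" for i
    by (auto simp: p_def q_def C2'_closed)
  show "cls {[p i, q j]} = cls (if i = j then {[]} else {})" for i j
    using cancel_letters[of "if i then p1 else p0" "if j then q1 else q0" "if i = j then {[]} else {}"]
    by (cases i; cases j) (simp_all add: p_def q_def C2_rel_def letters_def)
  show "cls {[a, c]} = cls {[c, a]}" if "a \<in> Inl ` dcar K" "c \<in> Inr ` dcar C2'" for a c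
    using that by (intro cls_relations) (auto simp: comm_rel_def)
qed

lemma normal_form_exists:
  assumes "\<phi> \<in> dcar (tensor K C2')"
  obtains n S F U X V where "n \<ge> 1" "bracket_system \<Sigma> (tensor_rho K C2') (Inl ` dcar K) (Inr ` dcar C2') p q U X V"
    "\<phi> = cls (accepted n S (\<lambda>i j. U i j \<union> X i j \<union> V i j) F)"
proof -
  obtain L0 where L0: "L0 \<in> reglang \<Sigma>" "\<phi> = cls L0"
    using assms by (auto simp: tensor_eq dcar_Q)
  then obtain L where L: "L \<in> reglang \<Gamma>" "\<phi> = cls L"
    using reduce_alphabet by blast
  \<comment> \<open>\<open>?U\<close> and \<open>?V\<close> hold just the entries allowed for
    \<open>U\<close> and \<open>V\<close>. The scalar class consists of whole languages over
    \<open>K\<close>, because the Kleene constructions add the empty word to its labels.\<close>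
  let ?U = "{{}, {[p False]}, {[p True]}}" and ?V = "{{}, {[q False]}, {[q True]}}"
    and ?X = "{L \<in> reglang \<Sigma>. L \<subseteq> lists (Inl ` dcar K)}"
  interpret label_classes ?U ?X ?V
    by unfold_locales (auto simp: rl_empty reglang_insert)
  have "recognizable L"
  proof (rule recognizable_reglang[OF L(1)])
    fix x assume "x \<in> \<Gamma>"
    then consider a where "x = Inl a" "a \<in> dcar K" | y where "x = Inr (gen y)"
      by (auto simp: \<Gamma>_def)
    then show "{[x]} \<in> ?U \<union> ?X \<union> ?V"
    proof cases
      case 1
      then show ?thesis by (auto simp: reglang_word)
    next
      case 2
      then show ?thesis by (cases y) (auto simp: p_def q_def)
    qed
  qed
  then obtain n S F U X V where *: "n \<ge> 1" "\<And>i j. U i j \<in> ?U" "\<And>i j. X i j \<in> ?X" "\<And>i j. V i j \<in> ?V"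
    "L = accepted n S (\<lambda>i j. U i j \<union> X i j \<union> V i j) F"
    by (elim recognizableE) (rule that)
  have "bracket_system \<Sigma> (tensor_rho K C2') (Inl ` dcar K) (Inr ` dcar C2') p q U X V"
    using *(2-4) by unfold_locales auto
  with * L(2) show ?thesis by (intro that) auto
qed

lemma mleq_cls:
  "(\<And>i j. M i j \<in> reglang \<Sigma>) \<Longrightarrow> (\<And>i j. M' i j \<in> reglang \<Sigma>) \<Longrightarrow>
    mleq Q n (\<lambda>i j. cls (M i j)) (\<lambda>i j. cls (M' i j)) \<longleftrightarrow> (\<forall>i<n. \<forall>j<n. M i j \<subseteq> hull (M' i j))"
  by (simp add: mleq_def dleq_Q)

lemma tensor_bracket_letters:
  "inR K C2' (gen p0) = cls {[p False]}" "inR K C2' (gen p1) = cls {[p True]}"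
  "inR K C2' (gen q0) = cls {[q False]}" "inR K C2' (gen q1) = cls {[q True]}"
  by (simp_all add: inR_eq p_def q_def)

lemma ZC_I:
  assumes "L \<in> reglang \<Sigma>"
    and "\<And>c. c \<in> Inr ` dcar C2' \<Longrightarrow> cls (lconc L {[c]}) = cls (lconc {[c]} L)"
  shows "cls L \<in> ZC K"
proof -
  have "dtimes Q (cls L) (inR K C2' c) = dtimes Q (inR K C2' c) (cls L)" if "c \<in> dcar C2'" for c
  proof -
    have "{[Inr c]} \<in> reglang \<Sigma>" using that by (simp add: reglang_word InrI)
    then show ?thesis using assms that by (simp add: inR_eq dtimes_Q)
  qed
  then show ?thesis using assms(1) by (simp add: ZC_def tensor_eq dcar_Q)
qed

lemma ZC_regular: "y \<in> ZC K \<Longrightarrow> \<exists>L\<in>reglang \<Sigma>. y = cls L"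
  by (auto simp: ZC_def tensor_eq dcar_Q)

end

theorem theorem10:
  fixes K :: "'k dioid" and \<phi> :: "('k + delta list set set) list set set"
  assumes "R_dioid K"
    and "\<phi> \<in> dcar (tensor K C2')"
  shows "\<exists>n S F U V N. n \<ge> 1 \<and>
     (\<forall>i<n. S i \<in> {dzero (tensor K C2'), dunit (tensor K C2')}) \<and>
     (\<forall>i<n. F i \<in> {dzero (tensor K C2'), dunit (tensor K C2')}) \<and>
     (\<forall>i<n. \<forall>j<n. U i j \<in> {dzero (tensor K C2'), inR K C2' (gen p0), inR K C2' (gen p1)}) \<and>
     (\<forall>i<n. \<forall>j<n. V i j \<in> {dzero (tensor K C2'), inR K C2' (gen q0), inR K C2' (gen q1)}) \<and>
     (\<forall>i<n. \<forall>j<n. N i j \<in> ZC K) \<and>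
     \<phi> = bil (tensor K C2') n S
            (mmul (tensor K C2') n
               (mat_star (tensor K C2') n (mmul (tensor K C2') n N V))
               (mmul (tensor K C2') n N
                  (mat_star (tensor K C2') n (mmul (tensor K C2') n U N)))) F \<and>
     mleq (tensor K C2') n
        (mat_star (tensor K C2') n (madd (tensor K C2') (mmul (tensor K C2') n U (mmul (tensor K C2') n N V)) N)) N \<and>
     (\<forall>Y. (\<forall>i<n. \<forall>j<n. Y i j \<in> ZC K) \<longrightarrow>
          mleq (tensor K C2') n
            (mat_star (tensor K C2') n (madd (tensor K C2') (mmul (tensor K C2') n U (mmul (tensor K C2') n Y V)) N)) Y \<longrightarrow>
          mleq (tensor K C2') n N Y)"
proof -
  interpret C2_tensor K using assms(1) by unfold_locales
  obtain n S F U X V where n: "n \<ge> 1"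
    and sys: "bracket_system \<Sigma> (tensor_rho K C2') (Inl ` dcar K) (Inr ` dcar C2') p q U X V"
    and \<phi>: "\<phi> = cls (accepted n S (\<lambda>i j. U i j \<union> X i j \<union> V i j) F)"
    by (rule normal_form_exists[OF assms(2)]) (rule that)
  interpret bracket_system \<Sigma> "tensor_rho K C2'" "Inl ` dcar K" "Inr ` dcar C2'" p q n U X V
    by (rule sys)
  let ?D = "tensor K C2'"
  let ?ind = "\<lambda>S i. if i \<in> S then {[]} else {}"
  let ?c = "\<lambda>M i j. cls (M i j)"
  note regs = N_regular U_regular V_regular NV_regular U_N_regular mat_star_reglang mmul_reglang
  have T: "mmul ?D n (mat_star ?D n (mmul ?D n (?c N) (?c V)))
      (mmul ?D n (?c N) (mat_star ?D n (mmul ?D n (?c U) (?c N)))) = ?c T"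
    unfolding tensor_eq T_def NV_def U_N_def by (simp add: mmul_Q mat_star_Q regs)
  have "\<phi> = cls (accepted n S A F)"
    unfolding \<phi> by (simp add: A_def[abs_def])
  also have "\<dots> = bil ?D n (\<lambda>i. cls (?ind S i)) (?c T) (\<lambda>i. cls (?ind F i))"
    unfolding accepted_normal_form tensor_eq by (intro bil_Q[symmetric] T_regular) (auto intro: rl_empty rl_eps)
  finally have \<phi>_eq: "\<phi> = bil ?D n (\<lambda>i. cls (?ind S i)) (?c T) (\<lambda>i. cls (?ind F i))" .
  have star_arg: "madd ?D (mmul ?D n (?c U) (mmul ?D n (?c M) (?c V))) (?c N)
      = (\<lambda>i j. cls (mmul (RL \<Sigma>) n U (mmul (RL \<Sigma>) n M V) i j \<union> N i j))"
    if "\<And>i j. M i j \<in> reglang \<Sigma>" for M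
    using that unfolding tensor_eq by (simp add: mmul_Q madd_Q regs)
  have star_reg: "mmul (RL \<Sigma>) n U (mmul (RL \<Sigma>) n M V) i j \<union> N i j \<in> reglang \<Sigma>"
    if "\<And>i j. M i j \<in> reglang \<Sigma>" for M i j
    using that by (intro rl_un regs) auto
  have star: "mat_star ?D n (madd ?D (mmul ?D n (?c U) (mmul ?D n (?c M) (?c V))) (?c N))
      = ?c (mat_star (RL \<Sigma>) n (\<lambda>i j. mmul (RL \<Sigma>) n U (mmul (RL \<Sigma>) n M V) i j \<union> N i j))"
    if "\<And>i j. M i j \<in> reglang \<Sigma>" for M
    unfolding star_arg[OF that] using star_reg[OF that] unfolding tensor_eq by (rule mat_star_Q)
  have solution: "mleq ?D n (mat_star ?D n (madd ?D (mmul ?D n (?c U) (mmul ?D n (?c N) (?c V))) (?c N))) (?c N)"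
    unfolding star[OF N_regular]
    unfolding tensor_eq using N_star star_reg[OF N_regular]
    by (subst mleq_cls) (auto simp: mat_star_RL NV_def intro: mat_star_reglang N_regular)
  have least: "mleq ?D n (?c N) Y"
    if Y: "\<forall>i<n. \<forall>j<n. Y i j \<in> ZC K"
      and le: "mleq ?D n (mat_star ?D n (madd ?D (mmul ?D n (?c U) (mmul ?D n Y (?c V))) (?c N))) Y" for Y
  proof -
    \<comment> \<open>Language representatives of the entries of \<open>Y\<close>. Outside the
      \<open>n \<times> n\<close> range \<open>Y\<close> is unconstrained, and the default
      \<open>{}\<close> makes \<open>y\<close> regular at every index, as the lemmas on classes
      require.\<close>
    define y where "y i j = (if i < n \<and> j < n then SOME L. L \<in> reglang \<Sigma> \<and> Y i j = cls L else {})" for i j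
    have y: "y i j \<in> reglang \<Sigma> \<and> (i < n \<longrightarrow> j < n \<longrightarrow> Y i j = cls (y i j))" for i j
      unfolding y_def using Y ZC_regular[of "Y i j"] someI_ex[of "\<lambda>L. L \<in> reglang \<Sigma> \<and> Y i j = cls L"]
      by (auto simp: rl_empty)
    then have y_reg: "y i j \<in> reglang \<Sigma>" for i j by blast
    let ?M = "\<lambda>i j. mmul (RL \<Sigma>) n U (mmul (RL \<Sigma>) n y V) i j \<union> N i j"
    \<comment> \<open>\<open>Y\<close> and its representatives agree only below \<open>n\<close>.
      The inner product thus needs \<open>i < n\<close>; the outer sum reads only such rows, so the
      full products agree at all indices.\<close>
    have "mmul ?D n Y (?c V) i j = mmul ?D n (?c y) (?c V) i j" if "i < n" for i j
      unfolding mmul_def using that y by (intro msum_cong) simp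
    then have "mmul ?D n (?c U) (mmul ?D n Y (?c V)) i j = mmul ?D n (?c U) (mmul ?D n (?c y) (?c V)) i j" for i j
      unfolding mmul_def[of _ _ "?c U"] by (intro msum_cong) simp
    then have "mmul ?D n (?c U) (mmul ?D n Y (?c V)) = mmul ?D n (?c U) (mmul ?D n (?c y) (?c V))"
      by blast
    then have "mleq ?D n (?c (mat_star (RL \<Sigma>) n ?M)) (?c y)"
      using le star[OF y_reg] y by (simp add: mleq_def)
    then have sub: "mat_star (RL \<Sigma>) n ?M i j \<subseteq> hull (y i j)" if "i < n" "j < n" for i j
      using that star_reg[OF y_reg] y_reg unfolding tensor_eq
      by (subst (asm) mleq_cls) (auto intro: mat_star_reglang)
    have "N i j \<subseteq> mat_star (RL \<Sigma>) n ?M i j" if "i < n" "j < n" for i j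
      using that star_reg[OF y_reg] by (auto simp: mat_star_RL intro: run_single)
    then have "mleq ?D n (?c N) (?c y)"
      unfolding tensor_eq using sub N_regular y_reg by (subst mleq_cls) blast+
    then show ?thesis using y by (simp add: mleq_def)
  qed
  have ZC: "cls (N i j) \<in> ZC K" for i j
    by (rule ZC_I[OF N_regular N_commute])
  show ?thesis
  proof (intro exI conjI)
    show "\<forall>i<n. cls (?ind S i) \<in> {dzero ?D, dunit ?D}" "\<forall>i<n. cls (?ind F i) \<in> {dzero ?D, dunit ?D}"
      by (simp_all add: tensor_eq dzero_Q dunit_Q)
    show "\<forall>i<n. \<forall>j<n. cls (U i j) \<in> {dzero ?D, inR K C2' (gen p0), inR K C2' (gen p1)}"
    proof (intro allI impI)
      fix i j
      show "cls (U i j) \<in> {dzero ?D, inR K C2' (gen p0), inR K C2' (gen p1)}"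
        using U[of i j]
        by (elim insertE emptyE) (simp_all add: tensor_bracket_letters tensor_eq dzero_Q)
    qed
    show "\<forall>i<n. \<forall>j<n. cls (V i j) \<in> {dzero ?D, inR K C2' (gen q0), inR K C2' (gen q1)}"
    proof (intro allI impI)
      fix i j
      show "cls (V i j) \<in> {dzero ?D, inR K C2' (gen q0), inR K C2' (gen q1)}"
        using V[of i j]
        by (elim insertE emptyE) (simp_all add: tensor_bracket_letters tensor_eq dzero_Q)
    qed
    show "\<phi> = bil ?D n (\<lambda>i. cls (?ind S i))
        (mmul ?D n (mat_star ?D n (mmul ?D n (?c N) (?c V)))
          (mmul ?D n (?c N) (mat_star ?D n (mmul ?D n (?c U) (?c N))))) (\<lambda>i. cls (?ind F i))"
      unfolding T by (rule \<phi>_eq)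
  qed (use n ZC solution least in blast)+
qed

end
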